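(* Let $N\geq 2$ be an integer and let $\{m(t)\}_{t=1}^{N-1}$ be a family of integers. Put $k=-\sum_{t=1}^{N-1}m(t)$. Then the product $$\prod_{t=1}^{N-1}\mathfrak{k}_{(\frac{t}{N},0)}(N\tau)^{m(t)}$$ is a nearly holomorphic modular form for $\Gamma_1(N)$ of weight $k$ if $$\sum_{t=1}^{N-1}m(t)t^2\equiv 0\pmod{\gcd(2,N)\cdot N}.$$ Furthermore, for every $\alpha=\begin{pmatrix}a&b\\c&d\end{pmatrix}\in\mathrm{SL}_2(\mathbb{Z})$, $$\mathrm{ord}_q\bigg(\bigg(\prod_{t=1}^{N-1}\mathfrak{k}_{(\frac{t}{N},0)}(N\tau)^{m(t)}\bigg)\bigg|[\alpha]_k\bigg)=\frac{\gcd(c,N)^2}{2N}\sum_{t=1}^{N-1}m(t)\bigg\langle\frac{at}{\gcd(c,N)}\bigg\rangle\bigg(\bigg\langle\frac{at}{\gcd(c,N)}\bigg\rangle-1\bigg).$$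
   Context: $\mathfrak{H}=\{\tau\in\mathbb{C}:\mathrm{Im}(\tau)>0\}$ and $q=e^{2\pi i\tau}$, with $q^{s}=e^{2\pi i s\tau}$ for $s\in\mathbb{Q}$. For $(r_1,r_2)\in\mathbb{Q}^2-\mathbb{Z}^2$ the Klein form is the holomorphic, nowhere vanishing function on $\mathfrak{H}$ $$\mathfrak{k}_{(r_1,r_2)}(\tau)=e^{\pi i r_2(r_1-1)}q^{\frac12 r_1(r_1-1)}(1-q_z)\prod_{n=1}^\infty(1-q^nq_z)(1-q^nq_z^{-1})(1-q^n)^{-2},$$ where $q_z=e^{2\pi i z}$ with $z=r_1\tau+r_2$. For an integer $k$, $\alpha=\begin{pmatrix}a&b\\c&d\end{pmatrix}\in\mathrm{SL}_2(\mathbb{Z})$ and a function $f$ on $\mathfrak{H}$, $f(\tau)|[\alpha]_k=(c\tau+d)^{-k}f\big(\frac{a\tau+b}{c\tau+d}\big)$. $\Gamma_1(N)=\{\alpha\in\mathrm{SL}_2(\mathbb{Z}):\alpha\equiv\begin{pmatrix}1&*\\0&1\end{pmatrix}\pmod N\}$. A holomorphic function $f$ on $\mathfrak{H}$ is a nearly holomorphic modular form for $\Gamma_1(N)$ of weight $k$ if $f|[\gamma]_k=f$ for all $\gamma\in\Gamma_1(N)$ and $f$ is meromorphic at every cusp (i.e. for every $\alpha\in\mathrm{SL}_2(\mathbb{Z})$, $f|[\alpha]_k$ has an expansion in powers of $q^{1/h}$, for some positive integer $h$, with only finitely many negative exponents). $\mathrm{ord}_q$ denotes the exponent of the lowest-order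 nonzero term in the expansion in (fractional) powers of $q$. $\langle X\rangle$ denotes the fractional part of $X\in\mathbb{R}$, $0\le\langle X\rangle<1$. *)

theory Defs
  imports "HOL-Analysis.Analysis" "HOL-Number_Theory.Cong"
begin

definition upper_half_plane :: "complex set" where
  "upper_half_plane = {\<tau>. Im \<tau> > 0}"

text \<open>\<open>qpow s \<tau>\<close> is $q^s = e^{2\pi i s\tau}$; in particular the nome is \<open>qpow 1 \<tau>\<close>.\<close>

definition qpow :: "real \<Rightarrow> complex \<Rightarrow> complex" where
  "qpow s \<tau> = exp (2 * of_real pi * \<i> * of_real s * \<tau>)"

text \<open>
  The Klein form with characteristic \<open>(r1, r2)\<close>. The factor $n \geq 1$ of the
  infinite product has index \<open>n - 1\<close>.
\<close>

definition klein_form :: "real \<Rightarrow> real \<Rightarrow> complex \<Rightarrow> complex" where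
  "klein_form r1 r2 \<tau> =
     (let q = qpow 1 \<tau>;
          z = of_real r1 * \<tau> + of_real r2;
          qz = exp (2 * of_real pi * \<i> * z)
      in exp (of_real pi * \<i> * of_real (r2 * (r1 - 1))) * qpow (r1 * (r1 - 1) / 2) \<tau> * (1 - qz) *
         (\<Prod>n. (1 - q ^ Suc n * qz) * (1 - q ^ Suc n * inverse qz) * inverse ((1 - q ^ Suc n) ^ 2)))"

definition klein_product :: "nat \<Rightarrow> (nat \<Rightarrow> int) \<Rightarrow> complex \<Rightarrow> complex" where
  "klein_product N m \<tau> =
     (\<Prod>t = 1..N - 1. klein_form (real t / real N) 0 (of_nat N * \<tau>) powi m t)"

definition SL2Z :: "(int ^ 2 ^ 2) set" where
  "SL2Z = {A. det A = 1}"

definition Gamma1 :: "nat \<Rightarrow> (int ^ 2 ^ 2) set" where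
  "Gamma1 N = {A \<in> SL2Z. [A $ 1 $ 1 = 1] (mod int N) \<and> [A $ 2 $ 1 = 0] (mod int N) \<and>
                         [A $ 2 $ 2 = 1] (mod int N)}"

definition slash :: "int \<Rightarrow> int ^ 2 ^ 2 \<Rightarrow> (complex \<Rightarrow> complex) \<Rightarrow> complex \<Rightarrow> complex" where
  "slash k A f \<tau> =
     (of_int (A $ 2 $ 1) * \<tau> + of_int (A $ 2 $ 2)) powi (- k) *
     f ((of_int (A $ 1 $ 1) * \<tau> + of_int (A $ 1 $ 2)) / (of_int (A $ 2 $ 1) * \<tau> + of_int (A $ 2 $ 2)))"

text \<open>
  \<open>has_q_expansion f h a\<close>: on the upper half plane, \<open>f\<close> is the sum of the series
  $\sum_{n \in \mathbb{Z}} a_n q^{n/h}$, which has only finitely many negative exponents.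
\<close>

definition has_q_expansion :: "(complex \<Rightarrow> complex) \<Rightarrow> nat \<Rightarrow> (int \<Rightarrow> complex) \<Rightarrow> bool" where
  "has_q_expansion f h a \<longleftrightarrow>
     h > 0 \<and> finite {n. n < 0 \<and> a n \<noteq> 0} \<and>
     (\<forall>\<tau>\<in>upper_half_plane.
        ((\<lambda>n. a n * qpow (real_of_int n / real h) \<tau>) has_sum f \<tau>) UNIV)"

text \<open>
  \<open>has_ord_q f s\<close> says that $\mathrm{ord}_q f$ exists and equals \<open>s\<close>; being a relation, it
  claims nothing by default about functions that vanish or have no expansion. That \<open>s\<close> is
  unique, and so does not depend on the choice of \<open>h\<close>, is \<open>has_ord_q_unique\<close> below.
\<close>

definition has_ord_q :: "(complex \<Rightarrow> complex) \<Rightarrow> real \<Rightarrow> bool" where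
  "has_ord_q f s \<longleftrightarrow>
     (\<exists>h a n. has_q_expansion f h a \<and> a n \<noteq> 0 \<and> (\<forall>j<n. a j = 0) \<and>
              s = real_of_int n / real h)"

definition nearly_holomorphic_modular_form ::
    "(int ^ 2 ^ 2) set \<Rightarrow> int \<Rightarrow> (complex \<Rightarrow> complex) \<Rightarrow> bool" where
  "nearly_holomorphic_modular_form \<Gamma> k f \<longleftrightarrow>
     f holomorphic_on upper_half_plane \<and>
     (\<forall>\<gamma>\<in>\<Gamma>. \<forall>\<tau>\<in>upper_half_plane. slash k \<gamma> f \<tau> = f \<tau>) \<and>
     (\<forall>\<alpha>\<in>SL2Z. \<exists>h a. has_q_expansion (slash k \<alpha> f) h a)"

lemma qpow_add: "qpow (s + t) \<tau> = qpow s \<tau> * qpow t \<tau>"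
  by (simp add: qpow_def exp_add [symmetric] algebra_simps)

lemma has_ord_q_limit:
  assumes "has_ord_q f s"
  obtains A where "A \<noteq> 0"
    "((\<lambda>y. f (\<i> * of_real y) * qpow (- s) (\<i> * of_real y)) \<longlongrightarrow> A) at_top"
proof -
  from assms obtain h a n where h: "h > 0" and an: "a n \<noteq> 0" and a0: "\<And>j. j < n \<Longrightarrow> a j = 0"
    and s: "s = real_of_int n / real h"
    and hs: "\<And>\<tau>. \<tau> \<in> upper_half_plane \<Longrightarrow>
      ((\<lambda>n. a n * qpow (real_of_int n / real h) \<tau>) has_sum f \<tau>) UNIV"
    unfolding has_ord_q_def has_q_expansion_def by blast
  define c where "c j = a (n + int j)" for j
  define w where "w y = (of_real (exp (- 2 * pi * y / real h)) :: complex)" for y :: real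
  have sums: "(\<lambda>j. c j * w y ^ j) sums (f (\<i> * of_real y) * qpow (- s) (\<i> * of_real y))"
    if y: "y > 0" for y
  proof -
    define \<tau> where "\<tau> = \<i> * complex_of_real y"
    have "((\<lambda>i. a i * qpow (real_of_int i / real h) \<tau>) has_sum f \<tau>) UNIV"
      using hs y by (simp add: \<tau>_def upper_half_plane_def)
    also have "?this \<longleftrightarrow> ((\<lambda>i. a i * qpow (real_of_int i / real h) \<tau>) has_sum f \<tau>)
                 (range (\<lambda>j. n + int j))"
    proof (rule has_sum_cong_neutral)
      fix i assume "i \<in> UNIV - range (\<lambda>j. n + int j)"
      moreover have "i = n + int (nat (i - n))" if "i \<ge> n" using that by simp
      ultimately have "i < n" by (metis DiffD2 not_le rangeI)
      thus "a i * qpow (real_of_int i / real h) \<tau> = 0" by (simp add: a0)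
    qed auto
    also have "\<dots> \<longleftrightarrow> (((\<lambda>i. a i * qpow (real_of_int i / real h) \<tau>) \<circ> (\<lambda>j. n + int j))
                 has_sum f \<tau>) UNIV"
      by (rule has_sum_reindex) (auto intro: injI)
    finally have "(((\<lambda>i. a i * qpow (real_of_int i / real h) \<tau>) \<circ> (\<lambda>j. n + int j))
                 has_sum f \<tau>) UNIV" .
    from has_sum_imp_sums [OF has_sum_cmult_right [OF this, of "qpow (- s) \<tau>"]]
    have *: "(\<lambda>j. qpow (- s) \<tau> * (a (n + int j) * qpow (real_of_int (n + int j) / real h) \<tau>))
            sums (qpow (- s) \<tau> * f \<tau>)"
      by (simp add: o_def)
    have "qpow (- s) \<tau> * qpow (real_of_int (n + int j) / real h) \<tau> = w y ^ j" for j
    proof -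
      have "qpow (- s) \<tau> * qpow (real_of_int (n + int j) / real h) \<tau> = qpow (real j / real h) \<tau>"
        by (simp add: qpow_add [symmetric] s add_divide_distrib)
      also have "\<dots> = of_real (exp (real j * (- 2 * pi * y / real h)))"
        by (simp add: qpow_def \<tau>_def exp_of_real [symmetric] algebra_simps)
      also have "\<dots> = w y ^ j"
        by (simp only: exp_of_nat_mult w_def of_real_power)
      finally show ?thesis .
    qed
    hence "qpow (- s) \<tau> * (a (n + int j) * qpow (real_of_int (n + int j) / real h) \<tau>) =
             c j * w y ^ j" for j
      by (metis c_def mult.left_commute)
    with * show ?thesis by (simp add: \<tau>_def mult.commute)
  qed
  define g where "g x = (\<Sum>j. c j * x ^ j)" for x
  have w1: "norm (w 1) > 0" by (simp add: w_def)
  have "(g \<longlongrightarrow> c 0) (at 0)"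
  proof (rule powser_limit_0 [OF w1])
    fix x :: complex assume "norm x < norm (w 1)"
    moreover have "summable (\<lambda>j. c j * w 1 ^ j)"
      using sums [of 1] sums_summable by simp
    ultimately have "summable (\<lambda>j. c j * x ^ j)"
      using powser_inside by blast
    thus "(\<lambda>j. c j * x ^ j) sums g x" by (simp add: g_def summable_sums)
  qed
  moreover have "filterlim w (at 0) at_top"
  proof (rule filterlim_atI)
    have "((\<lambda>y. exp (- 2 * pi * y / real h)) \<longlongrightarrow> 0) at_top"
    proof (rule filterlim_compose [OF exp_at_bot])
      have "filterlim (\<lambda>y. (- 2 * pi / real h) * y) at_bot at_top"
        using h by (intro filterlim_tendsto_neg_mult_at_bot [OF tendsto_const] filterlim_ident)
                   (simp_all add: divide_neg_pos)
      thus "filterlim (\<lambda>y. - 2 * pi * y / real h) at_bot at_top" by simp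
    qed
    from tendsto_of_real [OF this, where 'a = complex] show "(w \<longlongrightarrow> 0) at_top"
      unfolding w_def by simp
    show "\<forall>\<^sub>F y in at_top. w y \<noteq> 0" by (simp add: w_def)
  qed
  ultimately have "((\<lambda>y. g (w y)) \<longlongrightarrow> c 0) at_top"
    by (rule filterlim_compose)
  moreover have "\<forall>\<^sub>F y in at_top. g (w y) = f (\<i> * of_real y) * qpow (- s) (\<i> * of_real y)"
    using eventually_gt_at_top [of 0] by eventually_elim (metis g_def sums sums_unique)
  ultimately have "((\<lambda>y. f (\<i> * of_real y) * qpow (- s) (\<i> * of_real y)) \<longlongrightarrow> c 0) at_top"
    by (simp add: tendsto_cong)
  with an show thesis by (intro that [of "c 0"]) (auto simp: c_def)
qed

lemma has_ord_q_unique: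
  assumes "has_ord_q f s" "has_ord_q f t"
  shows "s = t"
proof -
  have "\<not> s < t" if st: "has_ord_q f s" "has_ord_q f t" for s t
  proof
    assume "s < t"
    from st(1) obtain A where A: "A \<noteq> 0"
      "((\<lambda>y. f (\<i> * of_real y) * qpow (- s) (\<i> * of_real y)) \<longlongrightarrow> A) at_top"
      by (rule has_ord_q_limit)
    from st(2) obtain B where
      B: "((\<lambda>y. f (\<i> * of_real y) * qpow (- t) (\<i> * of_real y)) \<longlongrightarrow> B) at_top"
      by (rule has_ord_q_limit)
    have "((\<lambda>y. exp (- 2 * pi * (t - s) * y)) \<longlongrightarrow> 0) at_top"
    proof (rule filterlim_compose [OF exp_at_bot])
      have "- 2 * pi * (t - s) < 0" using \<open>s < t\<close> by (simp add: mult_neg_pos)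
      thus "filterlim (\<lambda>y. - 2 * pi * (t - s) * y) at_bot at_top"
        by (rule filterlim_tendsto_neg_mult_at_bot [OF tendsto_const _ filterlim_ident])
    qed
    from tendsto_mult [OF B tendsto_of_real [OF this, where 'a = complex]]
    have "((\<lambda>y. f (\<i> * of_real y) * qpow (- t) (\<i> * of_real y) *
             of_real (exp (- 2 * pi * (t - s) * y))) \<longlongrightarrow> 0) at_top" by simp
    moreover have "qpow (- t) (\<i> * of_real y) * of_real (exp (- 2 * pi * (t - s) * y)) =
        qpow (- s) (\<i> * of_real y)" for y
      by (simp add: qpow_def exp_of_real [symmetric] exp_add [symmetric] algebra_simps)
    ultimately have "((\<lambda>y. f (\<i> * of_real y) * qpow (- s) (\<i> * of_real y)) \<longlongrightarrow> 0) at_top"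
      by (simp add: mult.assoc)
    with A show False using tendsto_unique [OF trivial_limit_at_top_linorder] by blast
  qed
  with assms show ?thesis by (meson linorder_less_linear)
qed

end

theory Submission
  imports Defs "HOL-Complex_Analysis.Cauchy_Integral_Formula"
begin

text \<open>
  Write \<open>z = r1 \<tau> + r2\<close>. Up to the factor \<open>exp (\<pi> \<i> r1 z)\<close>, the Klein form is the value at \<open>z\<close> of
  one function \<open>theta_quot z \<tau>\<close>, a constant multiple of the classical quotient of the odd Jacobi
  theta function by the cube of the eta function. Everything rests on its modular transformation
  law \<open>theta_quot_modular\<close>.

  That law is proved by Liouville's theorem, for an arbitrary matrix at once. For fixed \<open>\<tau>\<close> the two
  sides are entire functions of \<open>z\<close> with the same quasi-periods \<open>1\<close> and \<open>\<tau>\<close>, and the one in the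
  denominator has only simple zeros, at the lattice points, where the other vanishes too. Their
  quotient is thus entire and doubly periodic, hence constant. The constant can be read off at
  \<open>z = 0\<close>, because the derivative of \<open>theta_quot\<close> there is \<open>-2\<pi>\<i>\<close> for every \<open>\<tau>\<close>; this identifies it
  as \<open>1 / (c \<tau> + d)\<close>.

  In terms of Klein forms the law says that \<open>\<gamma>\<close> acts on the characteristic \<open>(r1, r2)\<close> as a row
  vector times a matrix (\<open>klein_form_modular\<close>), while quasi-periodicity says that an integral shift
  of the characteristic costs an explicit factor of absolute value \<open>1\<close> (\<open>klein_form_shift\<close>). For
  \<open>\<gamma>\<close> in \<open>\<Gamma>\<^sub>1(N)\<close> the conjugate of \<open>\<gamma>\<close> by \<open>diag(N, 1)\<close> is integral and moves \<open>(t/N, 0)\<close> by an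
  integral vector; the product of the resulting factors is \<open>1\<close> because of the congruence on
  \<open>\<Sum> m(t) t\<^sup>2\<close> (\<open>slash_Gamma1_klein_product\<close>).

  For a general \<open>\<alpha>\<close> one factors \<open>diag(N, 1) \<alpha>\<close> into an element of \<open>SL\<^sub>2(\<int>)\<close> times an upper
  triangular matrix with diagonal \<open>(g, N/g)\<close>, \<open>g = gcd c N\<close>. This turns the slashed product, up to
  a constant, into a product of Klein forms with first characteristic \<open>at/g\<close>, which may be reduced
  modulo \<open>1\<close>. The product formula of such a Klein form exhibits it as a power of \<open>x = q\<^bsup>1/(2N)\<^esup>\<close>
  times a function of \<open>x\<close> that is holomorphic and zero-free in the unit disc. Functions of this
  shape (\<open>q_unit_expansion\<close>) are closed under products and integer powers, are holomorphic on the
  upper half plane, and have the exponent of the power as their order, so holomorphy, meromorphy at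
  the cusps and the order formula come out together (\<open>q_unit_expansion_slash_klein_product\<close>).
\<close>

section \<open>The infinite q-Pochhammer symbol\<close>

definition q_pochhammer :: "complex \<Rightarrow> complex \<Rightarrow> complex" where
  "q_pochhammer q w = (\<Prod>n. 1 - q ^ n * w)"

lemma convergent_prod_q_pochhammer:
  fixes q w :: complex
  assumes "norm q < 1"
  shows "convergent_prod (\<lambda>n. 1 - q ^ n * w)"
proof -
  have "summable (\<lambda>n. norm w * norm q ^ n)"
    using assms by (intro summable_mult summable_geometric) auto
  then have "summable (\<lambda>n. norm (1 - q ^ n * w - 1))"
    by (simp add: norm_mult norm_power mult.commute)
  then show ?thesis
    by (intro abs_convergent_prod_imp_convergent_prod) (simp add: abs_convergent_prod_conv_summable)
qed

lemma convergent_prod_q_pochhammer_Suc: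
  fixes q w :: complex
  assumes "norm q < 1"
  shows "convergent_prod (\<lambda>n. 1 - q ^ Suc n * w)"
  using convergent_prod_q_pochhammer[OF assms, of "q * w"] by (simp add: ac_simps)

text \<open>Splitting off the first factor; this is the source of the quasi-periodicity below.\<close>

lemma q_pochhammer_mult_q:
  assumes "norm q < 1"
  shows "q_pochhammer q w = (1 - w) * q_pochhammer q (q * w)"
  using has_prod_ignore_initial_segment'[OF convergent_prod_q_pochhammer[OF assms, of w], of 1] 
  by (simp add: q_pochhammer_def has_prod_iff ac_simps)

lemma q_pochhammer_eq_0_iff:
  assumes "norm q < 1"
  shows "q_pochhammer q w = 0 \<longleftrightarrow> (\<exists>n. q ^ n * w = 1)"
proof
  assume "q_pochhammer q w = 0"
  then show "\<exists>n. q ^ n * w = 1"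
    using prodinf_nonzero[OF convergent_prod_q_pochhammer[OF assms, of w]] by (auto simp:
        q_pochhammer_def)
next
  assume "\<exists>n. q ^ n * w = 1"
  then obtain n where "q ^ n * w = 1" by blast
  moreover have "(\<lambda>n. 1 - q ^ n * w) has_prod q_pochhammer q w"
    unfolding q_pochhammer_def using assms
        by (intro convergent_prod_has_prod convergent_prod_q_pochhammer)
  ultimately show "q_pochhammer q w = 0"
    using has_prod_eq_0_iff by fastforce
qed

lemma q_pochhammer_nonzero:
  assumes "norm q < 1" "norm w \<le> 1" "w \<noteq> 1"
  shows "q_pochhammer q w \<noteq> 0"
proof
  assume "q_pochhammer q w = 0"
  then obtain n where n: "q ^ n * w = 1"
    using assms(1) q_pochhammer_eq_0_iff by blast
  with assms(3) have "n > 0" by (cases n) auto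
  have "norm (q ^ n * w) \<le> norm q ^ n * 1"
    unfolding norm_mult norm_power by (intro mult_left_mono assms) auto
  also have "\<dots> < 1"
    using assms(1) \<open>n > 0\<close> by (simp add: power_Suc_less_one power_less_one_iff)
  finally show False using n by simp
qed

text \<open>
  Both arguments may vary: the base is a constant when the variable is the elliptic one, but in the
  expansions at the cusps base and argument are both monomials in the local parameter. On a closed
  disc the factors differ from \<open>1\<close> by at most a fixed geometric sequence, so the products converge
  uniformly.
\<close>

lemma holomorphic_q_pochhammer:
  assumes S: "open S" and hq: "q holomorphic_on S" and hw: "w holomorphic_on S"
    and q1: "\<And>x. x \<in> S \<Longrightarrow> norm (q x) < 1"
  shows "(\<lambda>x. q_pochhammer (q x) (w x)) holomorphic_on S"
proof (rule holomorphic_uniform_sequence[OF S, where f = "\<lambda>N x. \<Prod>n<N. 1 - q x ^ n * w x"])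
  fix x assume "x \<in> S"
  with S obtain d where d: "d > 0" "cball x d \<subseteq> S"
    by (meson open_contains_cball)
  note cont = continuous_on_subset[OF holomorphic_on_imp_continuous_on[OF hq] d(2)]
    continuous_on_subset[OF holomorphic_on_imp_continuous_on[OF hw] d(2)]
  have ne: "cball x d \<noteq> {}" using d by auto
  obtain x0 where x0: "x0 \<in> cball x d" "\<And>y. y \<in> cball x d \<Longrightarrow> norm (q y) \<le> norm (q x0)"
    using continuous_attains_sup[OF compact_cball ne continuous_on_norm[OF cont(1)]] by blast
  obtain x1 where x1: "\<And>y. y \<in> cball x d \<Longrightarrow> norm (w y) \<le> norm (w x1)"
    using continuous_attains_sup[OF compact_cball ne continuous_on_norm[OF cont(2)]] by blast
  have "uniformly_convergent_on (cball x d) (\<lambda>N x. \<Prod>n<N. 1 - q x ^ n * w x)"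
  proof (rule uniformly_convergent_on_prod')
    show "uniformly_convergent_on (cball x d) (\<lambda>N x. \<Sum>n<N. norm (1 - q x ^ n * w x - 1))"
    proof (rule Weierstrass_m_test'[where M = "\<lambda>n. norm (q x0) ^ n * norm (w x1)"])
      fix n y assume "y \<in> cball x d"
      then show "norm (norm (1 - q y ^ n * w y - 1)) \<le> norm (q x0) ^ n * norm (w x1)"
        by (simp add: norm_mult norm_power) (intro mult_mono power_mono x0 x1; simp)
    next
      show "summable (\<lambda>n. norm (q x0) ^ n * norm (w x1))"
        using q1 x0(1) d(2) by (intro summable_mult2 summable_geometric) auto
    qed
  qed (auto intro!: continuous_intros cont)
  then obtain l where l: "uniform_limit (cball x d) (\<lambda>N x. \<Prod>n<N. 1 - q x ^ n * w x) l sequentially"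
    by (auto simp: uniformly_convergent_on_def)
  have "l y = q_pochhammer (q y) (w y)" if "y \<in> cball x d" for y
  proof -
    have "(\<lambda>N. \<Prod>n<N. 1 - q y ^ n * w y) \<longlonglongrightarrow> l y"
      using tendsto_uniform_limitI[OF l that] .
    moreover have "(\<lambda>N. \<Prod>n<N. 1 - q y ^ n * w y) \<longlonglongrightarrow> q_pochhammer (q y) (w y)"
      unfolding q_pochhammer_def using q1 d(2) that
      by (intro has_prod_imp_tendsto' convergent_prod_has_prod convergent_prod_q_pochhammer) auto
    ultimately show ?thesis using LIMSEQ_unique by blast
  qed
  then have "uniform_limit (cball x d) (\<lambda>N x. \<Prod>n<N. 1 - q x ^ n * w x) (\<lambda>x. q_pochhammer (q x)
      (w x)) sequentially"
    using l by (metis (no_types, lifting) uniform_limit_cong')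
  then show "\<exists>d>0. cball x d \<subseteq> S \<and>
     uniform_limit (cball x d) (\<lambda>N x. \<Prod>n<N. 1 - q x ^ n * w x) (\<lambda>x. q_pochhammer (q x) (w x))
         sequentially"
    using d by blast
qed (intro holomorphic_intros hq hw)

section \<open>The theta quotient and its quasi-periods\<close>

lemma norm_qpow_less_1:
  assumes "Im \<tau> > 0" "s > 0"
  shows "norm (qpow s \<tau>) < 1"
  using assms by (simp add: qpow_def norm_exp_eq_Re)

lemma qpow_nonzero [simp]: "qpow s \<tau> \<noteq> 0"
  by (simp add: qpow_def)

lemma exp_pi_i_even:
  assumes "even k"
  shows "exp (of_real pi * \<i> * of_int k) = 1"
proof -
  obtain l where "k = 2 * l" using assms by blast
  then show ?thesis
    using exp_integer_2pi[of "of_int l"] by (simp add: mult_ac)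
qed

lemma exp_pi_i_odd:
  assumes "odd k"
  shows "exp (of_real pi * \<i> * of_int k) = - 1"
proof -
  have "exp (of_real pi * \<i> * of_int k) = exp (of_real pi * \<i> * of_int (k - 1)) *
      exp (of_real pi * \<i>)"
    unfolding exp_add[symmetric] by (simp add: algebra_simps)
  then show ?thesis using exp_pi_i_even[of "k - 1"] assms by simp
qed

text \<open>
  This is \<open>-\<i> \<theta>\<^sub>1(z, \<tau>) / \<eta>(\<tau>)\<^sup>3\<close>. The factor \<open>1 - w\<close> that carries the zero at \<open>z = 0\<close> is the first
  factor of the first symbol.
\<close>

definition theta_quot :: "complex \<Rightarrow> complex \<Rightarrow> complex" where
  "theta_quot z \<tau> =
     (let q = qpow 1 \<tau>; w = exp (2 * of_real pi * \<i> * z)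
      in exp (- of_real pi * \<i> * z) * q_pochhammer q w * q_pochhammer q (q / w)
          / (q_pochhammer q q)\<^sup>2)"

lemma klein_form_eq:
  assumes "Im \<tau> > 0"
  shows "klein_form r1 r2 \<tau> =
           exp (of_real pi * \<i> * of_real r1 * (of_real r1 * \<tau> + of_real r2)) *
           theta_quot (of_real r1 * \<tau> + of_real r2) \<tau>"
proof -
  define q where "q = qpow 1 \<tau>"
  define z where "z = of_real r1 * \<tau> + of_real r2"
  define w where "w = exp (2 * of_real pi * \<i> * z)"
  have q1: "norm q < 1" unfolding q_def using assms by (intro norm_qpow_less_1) auto
  have conv: "convergent_prod (\<lambda>n. 1 - q ^ Suc n * u)" for u
    using q1 by (rule convergent_prod_q_pochhammer_Suc)
  have qpS: "(\<Prod>n. 1 - q ^ Suc n * u) = q_pochhammer q (q * u)" for u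
    by (simp add: q_pochhammer_def ac_simps)
  have conv1: "convergent_prod (\<lambda>n. 1 - q ^ Suc n)" using conv[of 1] by simp
  have qpS1: "(\<Prod>n. 1 - q ^ Suc n) = q_pochhammer q q" using qpS[of 1] by simp
  have "(\<Prod>n. (1 - q ^ Suc n * w) * (1 - q ^ Suc n * inverse w) * inverse ((1 - q ^ Suc n) ^ 2)) =
        (\<Prod>n. (1 - q ^ Suc n * w) * (1 - q ^ Suc n * inverse w)) *
        (\<Prod>n. inverse ((1 - q ^ Suc n) ^ 2))"
    by (intro prodinf_mult[symmetric] convergent_prod_mult conv convergent_prod_inverse
        convergent_prod_power conv1)
  also have "(\<Prod>n. (1 - q ^ Suc n * w) * (1 - q ^ Suc n * inverse w)) =
        q_pochhammer q (q * w) * q_pochhammer q (q * inverse w)"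
    by (subst prodinf_mult[symmetric]) (auto simp only: conv qpS)
  also have "(\<Prod>n. inverse ((1 - q ^ Suc n) ^ 2)) = inverse ((q_pochhammer q q)\<^sup>2)"
    by (subst prodinf_inverse, intro convergent_prod_power conv1)
       (simp only: prodinf_power[OF conv1] qpS1)
  finally have P: "(\<Prod>n. (1 - q ^ Suc n * w) * (1 - q ^ Suc n * inverse w) *
      inverse ((1 - q ^ Suc n) ^ 2)) =
     q_pochhammer q (q * w) * q_pochhammer q (q * inverse w) * inverse ((q_pochhammer q q)\<^sup>2)" .
  have E: "exp (of_real pi * \<i> * of_real (r2 * (r1 - 1))) * qpow (r1 * (r1 - 1) / 2) \<tau> =
        exp (of_real pi * \<i> * of_real r1 * z) * exp (- of_real pi * \<i> * z)"
    unfolding qpow_def z_def exp_add[symmetric] by (rule arg_cong[of _ _ exp]) (simp add: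
        field_simps)
  show ?thesis
    unfolding klein_form_def Let_def theta_quot_def q_def[symmetric] z_def[symmetric]
        w_def[symmetric]
      P E q_pochhammer_mult_q[OF q1, of w]
    by (simp only: divide_inverse mult_ac)
qed

lemma theta_quot_shift_1: "theta_quot (z + 1) \<tau> = - theta_quot z \<tau>"
proof -
  have "exp (2 * of_real pi * \<i> * (z + 1)) = exp (2 * of_real pi * \<i> * z)"
    using exp_pi_i_even[of 2] by (simp add: ring_distribs exp_add mult_ac)
  moreover have "exp (- of_real pi * \<i> * (z + 1)) = - exp (- of_real pi * \<i> * z)"
    using exp_pi_i by (simp add: ring_distribs exp_diff mult_ac)
  ultimately show ?thesis by (simp add: theta_quot_def Let_def)
qed

text \<open>
  Replacing \<open>z\<close> by \<open>z + \<tau>\<close> multiplies \<open>w\<close> by \<open>q\<close>, which moves one factor from the first symbol to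
  the second: \<open>1 - w\<close> is lost and \<open>1 - 1/w = -(1 - w)/w\<close> is gained.
\<close>

lemma theta_quot_shift_tau:
  assumes "Im \<tau> > 0"
  shows "theta_quot (z + \<tau>) \<tau> =
           - exp (- of_real pi * \<i> * \<tau> - 2 * of_real pi * \<i> * z) * theta_quot z \<tau>"
proof -
  define q where "q = qpow 1 \<tau>"
  define w where "w = exp (2 * of_real pi * \<i> * z)"
  have q1: "norm q < 1" unfolding q_def using assms by (intro norm_qpow_less_1) auto
  have [simp]: "w \<noteq> 0" "q \<noteq> 0" by (auto simp: w_def q_def)
  have w': "exp (2 * of_real pi * \<i> * (z + \<tau>)) = q * w"
    by (simp add: w_def q_def qpow_def ring_distribs exp_add)
  have e: "exp (- of_real pi * \<i> * (z + \<tau>)) =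
      exp (- of_real pi * \<i> * \<tau> - 2 * of_real pi * \<i> * z) * exp (- of_real pi * \<i> * z) * w"
    unfolding w_def by (simp flip: exp_add add: algebra_simps)
  have "q_pochhammer q (1 / w) = (1 - 1 / w) * q_pochhammer q (q / w)"
    using q_pochhammer_mult_q[OF q1, of "1 / w"] by simp
  then have "w * q_pochhammer q (1 / w) = - (1 - w) * q_pochhammer q (q / w)"
    by (simp add: field_simps)
  then have "w * (q_pochhammer q (q * w) * q_pochhammer q (q / (q * w))) = - (((1 - w) *
      q_pochhammer q (q * w)) * q_pochhammer q (q / w))"
    by simp algebra
  then have *: "w * (q_pochhammer q (q * w) * q_pochhammer q (q / (q * w))) =
      - (q_pochhammer q w * q_pochhammer q (q / w))"
    unfolding q_pochhammer_mult_q[OF q1, of w, symmetric] .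
  define E where "E = exp (- of_real pi * \<i> * \<tau> - 2 * of_real pi * \<i> * z)"
  have "theta_quot (z + \<tau>) \<tau> = E *
     exp (- of_real pi * \<i> * z) * (w * (q_pochhammer q (q * w) * q_pochhammer q (q / (q * w))))
         / (q_pochhammer q q)\<^sup>2"
    unfolding theta_quot_def Let_def q_def[symmetric] w' e E_def by (simp only: mult_ac)
  also have "\<dots> = - E * theta_quot z \<tau>"
    unfolding * theta_quot_def Let_def q_def[symmetric] w_def[symmetric] by simp
  finally show ?thesis by (simp only: E_def)
qed

lemma theta_quot_shift:
  assumes "Im \<tau> > 0"
  shows "theta_quot (z + of_int m * \<tau> + of_int n) \<tau> =
     exp (of_real pi * \<i> * (of_int (m + n) - of_int m ^ 2 * \<tau> - 2 * of_int m * z)) * theta_quot z \<tau>"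
proof -
  have n: "theta_quot (z + of_int n) \<tau> = exp (of_real pi * \<i> * of_int n) * theta_quot z \<tau>" for z
  proof (induction n rule: int_induct[where k = 0])
    case (step1 n)
    have "theta_quot (z + of_int (n + 1)) \<tau> = - theta_quot (z + of_int n) \<tau>"
      using theta_quot_shift_1[of "z + of_int n"] by (simp add: add.assoc)
    then show ?case using step1 by (simp add: ring_distribs exp_add)
  next
    case (step2 n)
    have "theta_quot (z + of_int n) \<tau> = - theta_quot (z + of_int (n - 1)) \<tau>"
      using theta_quot_shift_1[of "z + of_int (n - 1)"] by (simp add: add.assoc)
    then have "theta_quot (z + of_int (n - 1)) \<tau> = - theta_quot (z + of_int n) \<tau>" by simp
    then show ?case using step2 by (simp add: ring_distribs exp_diff)
  qed auto
  define E where "E m = exp (of_real pi * \<i> * (of_int m - of_int m ^ 2 * \<tau> - 2 * of_int m * z))"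
      for m :: int
  have E: "E (m + 1) = - exp (- of_real pi * \<i> * \<tau> - 2 * of_real pi * \<i> * (z + of_int m * \<tau>)) *
      E m" for m
  proof -
    have "- exp (- of_real pi * \<i> * \<tau> - 2 * of_real pi * \<i> * (z + of_int m * \<tau>)) * E m =
       exp (of_real pi * \<i>) * exp (- of_real pi * \<i> * \<tau> - 2 * of_real pi * \<i> * (z + of_int m *
           \<tau>)) * E m"
      by simp
    also have "\<dots> = E (m + 1)"
      unfolding E_def exp_add[symmetric] by (rule arg_cong[of _ _ exp]) (simp add:
          algebra_simps power2_eq_square)
    finally show ?thesis by simp
  qed
  have step: "theta_quot (z + of_int (m + 1) * \<tau>) \<tau> =
      - exp (- of_real pi * \<i> * \<tau> - 2 * of_real pi * \<i> * (z + of_int m * \<tau>)) *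
        theta_quot (z + of_int m * \<tau>) \<tau>" for m
    using theta_quot_shift_tau[OF assms, of "z + of_int m * \<tau>"] by (simp add: algebra_simps)
  have m: "theta_quot (z + of_int m * \<tau>) \<tau> = E m * theta_quot z \<tau>"
  proof (induction m rule: int_induct[where k = 0])
    case base
    show ?case by (simp add: E_def)
  next
    case (step1 m)
    then show ?case unfolding step E by simp
  next
    case (step2 m)
    show ?case
      using step2(2) step[of "m - 1"] E[of "m - 1"] by simp
  qed
  have "theta_quot (z + of_int m * \<tau> + of_int n) \<tau> = exp (of_real pi * \<i> * of_int n) * E m *
      theta_quot z \<tau>"
    by (simp add: n m)
  also have "exp (of_real pi * \<i> * of_int n) * E m =
     exp (of_real pi * \<i> * (of_int (m + n) - of_int m ^ 2 * \<tau> - 2 * of_int m * z))"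
    unfolding E_def exp_add[symmetric] by (rule arg_cong[of _ _ exp]) (simp add: algebra_simps)
  finally show ?thesis .
qed

lemma theta_quot_eq_0_iff:
  assumes "Im \<tau> > 0"
  shows "theta_quot z \<tau> = 0 \<longleftrightarrow> (\<exists>m n. z = of_int m * \<tau> + of_int n)"
proof
  assume "\<exists>m n. z = of_int m * \<tau> + of_int n"
  then obtain m n where z: "z = 0 + of_int m * \<tau> + of_int n" by auto
  have "norm (qpow 1 \<tau>) < 1" using assms by (intro norm_qpow_less_1) auto
  then have "theta_quot 0 \<tau> = 0"
    by (simp add: theta_quot_def Let_def q_pochhammer_mult_q[of _ 1])
  then show "theta_quot z \<tau> = 0"
    unfolding z theta_quot_shift[OF assms] by simp
next
  assume 0: "theta_quot z \<tau> = 0"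
  define q where "q = qpow 1 \<tau>"
  define w where "w = exp (2 * of_real pi * \<i> * z)"
  have q1: "norm q < 1" unfolding q_def using assms by (intro norm_qpow_less_1) auto
  have "q_pochhammer q q \<noteq> 0" using q1 by (intro q_pochhammer_nonzero) auto
  with 0 have "q_pochhammer q w = 0 \<or> q_pochhammer q (q / w) = 0"
    by (auto simp: theta_quot_def Let_def q_def w_def)
  then obtain m :: int where m: "exp (2 * of_real pi * \<i> * (of_int m * \<tau> + z)) = 1"
  proof
    assume "q_pochhammer q w = 0"
    then obtain n where "q ^ n * w = 1" using q_pochhammer_eq_0_iff[OF q1] by blast
    moreover have "q ^ n * w = exp (2 * of_real pi * \<i> * (of_int (int n) * \<tau> + z))"
      by (simp add: q_def w_def qpow_def exp_of_nat_mult[symmetric] exp_add[symmetric]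
          algebra_simps)
    ultimately show thesis using that[of "int n"] by simp
  next
    assume "q_pochhammer q (q / w) = 0"
    then obtain n where "q ^ n * (q / w) = 1" using q_pochhammer_eq_0_iff[OF q1] by blast
    moreover have "q ^ n * (q / w) = exp (- (2 * of_real pi * \<i> * (of_int (- int n - 1) * \<tau> + z)))"
      by (simp add: q_def w_def qpow_def exp_of_nat_mult[symmetric] exp_add[symmetric]
          exp_diff[symmetric] algebra_simps)
    ultimately have "exp (2 * of_real pi * \<i> * (of_int (- int n - 1) * \<tau> + z)) = 1"
      by (simp only: exp_minus inverse_eq_1_iff)
    then show thesis using that by blast
  qed
  then obtain n :: int where "2 * of_real pi * \<i> * (of_int m * \<tau> + z) = of_int (2 * n) *
      of_real pi * \<i>"
    using exp_eq[of "2 * of_real pi * \<i> * (of_int m * \<tau> + z)" 0] by auto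
  then have "2 * of_real pi * \<i> * (of_int m * \<tau> + z) = 2 * of_real pi * \<i> * of_int n"
    by simp
  then have "of_int m * \<tau> + z = of_int n"
    by (subst (asm) mult_cancel_left) simp
  then have "z = of_int (- m) * \<tau> + of_int n" by (simp add: algebra_simps)
  then show "\<exists>m n. z = of_int m * \<tau> + of_int n" by blast
qed

lemma holomorphic_theta_quot:
  assumes "Im \<tau> > 0"
  shows "(\<lambda>z. theta_quot z \<tau>) holomorphic_on A"
proof -
  have q1: "norm (qpow 1 \<tau>) < 1" using assms by (intro norm_qpow_less_1) auto
  have "q_pochhammer (qpow 1 \<tau>) (qpow 1 \<tau>) \<noteq> 0" using q1 by (intro q_pochhammer_nonzero) auto
  then have "(\<lambda>z. theta_quot z \<tau>) holomorphic_on UNIV"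
    unfolding theta_quot_def Let_def
    by (intro holomorphic_intros holomorphic_q_pochhammer) (auto simp: q1)
  then show ?thesis by (rule holomorphic_on_subset) auto
qed

lemma theta_quot_0:
  assumes "Im \<tau> > 0"
  shows "theta_quot 0 \<tau> = 0"
  unfolding theta_quot_eq_0_iff[OF assms] by (intro exI[of _ 0]) auto

text \<open>
  Without its vanishing factor \<open>1 - w\<close>, the theta quotient takes the value \<open>1\<close> at \<open>z = 0\<close>: the
  denominator \<open>(q; q)\<^sup>2\<close> is there to achieve this.
\<close>

lemma theta_quot_deriv_0:
  assumes "Im \<tau> > 0"
  shows "((\<lambda>z. theta_quot z \<tau>) has_field_derivative (- 2 * of_real pi * \<i>)) (at 0)"
proof -
  define q where "q = qpow 1 \<tau>"
  have q1: "norm q < 1" unfolding q_def using assms by (intro norm_qpow_less_1) auto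
  have q0: "q_pochhammer q q \<noteq> 0" using q1 by (intro q_pochhammer_nonzero) auto
  define w where "w z = exp (2 * of_real pi * \<i> * z)" for z
  define g where "g z = exp (- of_real pi * \<i> * z) * q_pochhammer q (q * w z) *
      q_pochhammer q (q / w z) / (q_pochhammer q q)\<^sup>2" for z
  have "g holomorphic_on UNIV"
    unfolding g_def w_def using q0 by (intro holomorphic_intros holomorphic_q_pochhammer)
        (auto simp: q1)
  then have "(g has_field_derivative deriv g 0) (at 0)"
    by (intro holomorphic_derivI) auto
  moreover have "((\<lambda>z. 1 - w z) has_field_derivative (- 2 * of_real pi * \<i>)) (at 0)"
    unfolding w_def by (auto intro!: derivative_eq_intros)
  ultimately have "((\<lambda>z. g z * (1 - w z)) has_field_derivative
       deriv g 0 * (1 - w 0) + (- 2 * of_real pi * \<i>) * g 0) (at 0)"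
    by (rule DERIV_mult)
  moreover have "w 0 = 1" by (simp add: w_def)
  moreover have "g 0 = 1" using q0 by (simp add: g_def w_def power2_eq_square)
  moreover have "theta_quot z \<tau> = g z * (1 - w z)" for z
    unfolding theta_quot_def Let_def g_def q_def[symmetric] w_def[symmetric]
        q_pochhammer_mult_q[OF q1, of "w z"]
    by (simp only: divide_inverse mult_ac)
  ultimately show ?thesis by simp
qed

section \<open>The modular transformation of the theta quotient\<close>

lemma moebius_denom_nonzero:
  fixes c d :: int
  assumes "Im \<tau> > 0" "c \<noteq> 0 \<or> d \<noteq> 0"
  shows "of_int c * \<tau> + of_int d \<noteq> 0"
proof
  assume 0: "of_int c * \<tau> + of_int d = 0"
  from arg_cong[OF this, of Im] have "c = 0" using assms(1) by simp
  with 0 assms(2) show False by simp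
qed

lemma moebius_Im_pos:
  fixes a b c d :: int
  assumes "Im \<tau> > 0" "a * d - b * c = 1"
  shows "Im ((of_int a * \<tau> + of_int b) / (of_int c * \<tau> + of_int d)) > 0"
proof -
  have "c \<noteq> 0 \<or> d \<noteq> 0" using assms(2) by auto
  then have j: "of_int c * \<tau> + of_int d \<noteq> 0" using moebius_denom_nonzero assms(1) by blast
  have "real_of_int a * of_int d - of_int b * of_int c = 1"
    using assms(2) by (simp flip: of_int_mult of_int_diff)
  then have "Im \<tau> = Im \<tau> * (of_int a * of_int d - of_int b * of_int c)" by simp
  also have "\<dots> = Im (of_int a * \<tau> + of_int b) * Re (of_int c * \<tau> + of_int d) -
     Re (of_int a * \<tau> + of_int b) * Im (of_int c * \<tau> + of_int d)"
    by (simp add: algebra_simps)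
  finally show ?thesis
    using assms(1) j unfolding Im_divide
    by (intro divide_pos_pos) (auto simp: complex_eq_iff sum_power2_gt_zero_iff)
qed

text \<open>All values are taken on the compact period parallelogram, so Liouville's theorem applies.\<close>

lemma entire_doubly_periodic_imp_constant:
  fixes f :: "complex \<Rightarrow> complex"
  assumes "Im \<tau> > 0" and hol: "f holomorphic_on UNIV"
    and per: "\<And>z m n. f (z + of_int m * \<tau> + of_int n) = f z"
  shows "f z = f w"
proof -
  define K where "K = (\<lambda>(x, y). complex_of_real x + of_real y * \<tau>) ` ({0..1} \<times> {0..1})"
  have "compact K"
    unfolding K_def
    by (intro compact_continuous_image compact_Times compact_Icc)
       (auto simp: case_prod_beta intro!: continuous_intros)
  have "range f \<subseteq> f ` K"
  proof clarify
    fix z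
    define y where "y = Im z / Im \<tau>"
    define x where "x = Re z - y * Re \<tau>"
    have z: "z = of_real x + of_real y * \<tau>"
      using assms(1) by (simp add: complex_eq_iff x_def y_def)
    have "f z = f (of_real (frac x) + of_real (frac y) * \<tau> + of_int \<lfloor>y\<rfloor> * \<tau> + of_int \<lfloor>x\<rfloor>)"
      by (rule arg_cong[of _ _ f]) (simp add: z frac_def algebra_simps)
    also have "\<dots> = f (of_real (frac x) + of_real (frac y) * \<tau>)" by (rule per)
    also have "\<dots> \<in> f ` K"
      unfolding K_def by (intro imageI image_eqI[of _ _ "(frac x, frac y)"])
        (auto simp: frac_lt_1 less_imp_le)
    finally show "f z \<in> f ` K" .
  qed
  moreover have "bounded (f ` K)"
    using hol \<open>compact K\<close>
    by (intro compact_imp_bounded compact_continuous_image holomorphic_on_imp_continuous_on)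
       (auto elim: holomorphic_on_subset)
  ultimately have "f constant_on UNIV"
    using Liouville_theorem[OF hol] bounded_subset by blast
  then show ?thesis by (auto simp: constant_on_def)
qed

lemma periodic_lattice:
  fixes f :: "complex \<Rightarrow> 'a"
  assumes 1: "\<And>z. f (z + 1) = f z" and 2: "\<And>z. f (z + \<tau>) = f z"
  shows "f (z + of_int m * \<tau> + of_int n) = f z"
proof -
  have *: "f (z + of_int n * p) = f z" if p: "\<And>z. f (z + p) = f z" for z p n
  proof (induction n rule: int_induct[where k = 0])
    case (step1 n)
    then show ?case using p[of "z + of_int n * p"] by (simp add: algebra_simps)
  next
    case (step2 n)
    then show ?case using p[of "z + of_int (n - 1) * p"] by (simp add: algebra_simps)
  qed auto
  show ?thesis
    using *[OF 1, of "z + of_int m * \<tau>" n] *[OF 2, of z m] by simp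
qed

lemma simple_zero_factor:
  assumes "f holomorphic_on UNIV" "f 0 = 0" "(f has_field_derivative f') (at 0)"
  obtains g where "g holomorphic_on UNIV" "g 0 = f'" "\<And>z. f z = z * g z"
proof
  show "(\<lambda>z. if z = 0 then deriv f 0 else (f z - f 0) / (z - 0)) holomorphic_on UNIV"
    using assms(1) by (intro pole_lemma) auto
qed (use assms in \<open>auto simp: DERIV_imp_deriv\<close>)

text \<open>
  With \<open>\<tau>' = (a \<tau> + b) / j\<close>, the lattice spanned by \<open>1/j\<close> and \<open>\<tau>/j\<close> is the one spanned by \<open>1\<close> and
  \<open>\<tau>'\<close>. The exponential of \<open>z\<^sup>2\<close> is what makes the quasi-period factors of \<open>F\<close> agree with those of
  \<open>theta_quot z \<tau>\<close>.
\<close>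

theorem theta_quot_modular:
  fixes a b c d :: int
  assumes \<tau>: "Im \<tau> > 0" and det: "a * d - b * c = 1"
  defines "j \<equiv> of_int c * \<tau> + of_int d"
  shows "theta_quot (z / j) ((of_int a * \<tau> + of_int b) / j) =
           exp (of_real pi * \<i> * of_int c * z\<^sup>2 / j) / j * theta_quot z \<tau>"
proof -
  define \<tau>' where "\<tau>' = (of_int a * \<tau> + of_int b) / j"
  have "c \<noteq> 0 \<or> d \<noteq> 0" using det by auto
  then have j: "j \<noteq> 0" unfolding j_def using moebius_denom_nonzero \<tau> by blast
  have \<tau>': "Im \<tau>' > 0" unfolding \<tau>'_def j_def by (rule moebius_Im_pos[OF \<tau> det])
  have det': "of_int a * of_int d - of_int b * of_int c = (1 :: complex)"
    using det by (simp flip: of_int_mult of_int_diff)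
  have j1: "1 / j = of_int a - of_int c * \<tau>'"
    unfolding \<tau>'_def using j det' by (simp add: field_simps) (simp add: j_def, algebra)
  have j2: "\<tau> / j = of_int d * \<tau>' - of_int b"
    unfolding \<tau>'_def using j det' by (simp add: field_simps) (simp add: j_def algebra_simps)
  define \<theta> where "\<theta> z = theta_quot z \<tau>" for z
  define F where "F z = theta_quot (z / j) \<tau>' * exp (- of_real pi * \<i> * of_int c * z\<^sup>2 / j)" for z
  have F_hol: "F holomorphic_on UNIV"
  proof -
    have "((\<lambda>z. theta_quot z \<tau>') \<circ> (\<lambda>z. z / j)) holomorphic_on UNIV"
      using j by (intro holomorphic_on_compose holomorphic_theta_quot \<tau>' holomorphic_intros) auto
    then show ?thesis
      unfolding F_def using j by (intro holomorphic_intros) (auto simp: o_def)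
  qed
  have \<theta>_hol: "\<theta> holomorphic_on UNIV"
    unfolding \<theta>_def using \<tau> by (rule holomorphic_theta_quot)
  \<comment> \<open>\<open>F\<close> has the same factor of automorphy as \<open>\<theta>\<close> under \<open>1\<close>. The sign comes out right because
    \<open>a\<close> and \<open>c\<close> are not both even.\<close>
  have F1: "F (z + 1) = - F z" for z
  proof -
    have "theta_quot ((z + 1) / j) \<tau>' = theta_quot (z / j + of_int (- c) * \<tau>' + of_int a) \<tau>'"
      by (rule arg_cong[of _ _ "\<lambda>x. theta_quot x \<tau>'"]) (simp add: add_divide_distrib j1)
    also have "\<dots> = exp (of_real pi * \<i> * (of_int (- c + a) - of_int (- c) ^ 2 * \<tau>' - 2 *
        of_int (- c) * (z / j))) *
          theta_quot (z / j) \<tau>'"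
      by (rule theta_quot_shift[OF \<tau>'])
    finally have "F (z + 1) = exp (of_real pi * \<i> * (of_int (- c + a) - of_int (- c) ^ 2 *
        \<tau>' - 2 * of_int (- c) * (z / j))
         - of_real pi * \<i> * of_int c * (z + 1)\<^sup>2 / j) * theta_quot (z / j) \<tau>'"
      by (simp add: F_def exp_add exp_diff exp_minus field_simps)
    also have "of_real pi * \<i> * (of_int (- c + a) - of_int (- c) ^ 2 * \<tau>' - 2 * of_int (- c) *
        (z / j))
         - of_real pi * \<i> * of_int c * (z + 1)\<^sup>2 / j =
        of_real pi * \<i> * (of_int (- c + a) - of_int c * (of_int c * \<tau>' + 1 / j)) - of_real pi *
            \<i> * of_int c * z\<^sup>2 / j"
      by (simp add: field_simps j power2_eq_square)
    also have "\<dots> = of_real pi * \<i> * of_int (- c + a - c * a) + (- of_real pi * \<i> * of_int c *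
        z\<^sup>2 / j)"
      by (simp add: j1)
    also have "exp \<dots> * theta_quot (z / j) \<tau>' = exp (of_real pi * \<i> * of_int (- c + a - c * a)) *
        F z"
      unfolding exp_add F_def by simp
    also have "exp (of_real pi * \<i> * of_int (- c + a - c * a)) = - 1"
    proof -
      have "odd a \<or> odd c" using det by (metis dvd_diff dvd_mult dvd_mult2 odd_one)
      then have "odd (- c + a - c * a)" by auto
      then show ?thesis by (rule exp_pi_i_odd)
    qed
    finally show ?thesis by simp
  qed
  \<comment> \<open>The same under \<open>\<tau>\<close>; here \<open>b\<close> and \<open>d\<close> are not both even.\<close>
  have F2: "F (z + \<tau>) = - exp (- of_real pi * \<i> * \<tau> - 2 * of_real pi * \<i> * z) * F z" for z
  proof -
    have "theta_quot ((z + \<tau>) / j) \<tau>' = theta_quot (z / j + of_int d * \<tau>' + of_int (- b)) \<tau>'"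
      by (rule arg_cong[of _ _ "\<lambda>x. theta_quot x \<tau>'"]) (simp add: add_divide_distrib j2)
    also have "\<dots> = exp (of_real pi * \<i> * (of_int (d + - b) - of_int d ^ 2 * \<tau>' - 2 * of_int d *
        (z / j))) *
          theta_quot (z / j) \<tau>'"
      by (rule theta_quot_shift[OF \<tau>'])
    finally have "F (z + \<tau>) = exp (of_real pi * \<i> * (of_int (d + - b) - of_int d ^ 2 * \<tau>' - 2 *
        of_int d * (z / j))
         - of_real pi * \<i> * of_int c * (z + \<tau>)\<^sup>2 / j) * theta_quot (z / j) \<tau>'"
      by (simp add: F_def exp_add exp_diff exp_minus field_simps)
    also have "of_real pi * \<i> * (of_int (d + - b) - of_int d ^ 2 * \<tau>' - 2 * of_int d * (z / j))
         - of_real pi * \<i> * of_int c * (z + \<tau>)\<^sup>2 / j =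
        of_real pi * \<i> * of_int (d - b) - of_real pi * \<i> * (of_int d ^ 2 * \<tau>' + of_int c * \<tau> *
            (\<tau> / j)) 
         - 2 * of_real pi * \<i> * z * ((of_int c * \<tau> + of_int d) / j) - of_real pi * \<i> *
             of_int c * z\<^sup>2 / j"
      by (simp add: field_simps j power2_eq_square)
    also have "(of_int c * \<tau> + of_int d) / j = 1" using j by (simp add: j_def)
    also have "of_int c * \<tau> = j - of_int d" by (simp add: j_def)
    also have "of_int d ^ 2 * \<tau>' + (j - of_int d) * (\<tau> / j) = \<tau> + of_int (d * b)"
    proof -
      have "(j - of_int d) * (\<tau> / j) = \<tau> - of_int d * (\<tau> / j)"
        using j by (simp add: field_simps)
      then show ?thesis by (simp add: j2 algebra_simps power2_eq_square)
    qed
    also have "of_real pi * \<i> * of_int (d - b) - of_real pi * \<i> * (\<tau> + of_int (d * b)) - 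
        2 * of_real pi * \<i> * z * 1 - of_real pi * \<i> * of_int c * z\<^sup>2 / j =
       of_real pi * \<i> * of_int (d - b - d * b) + (- of_real pi * \<i> * \<tau> - 2 * of_real pi * \<i> * z)
         + (- of_real pi * \<i> * of_int c * z\<^sup>2 / j)"
      by (simp add: algebra_simps)
    also have "exp \<dots> * theta_quot (z / j) \<tau>' = 
       exp (of_real pi * \<i> * of_int (d - b - d * b)) * exp (- of_real pi * \<i> * \<tau> - 2 *
           of_real pi * \<i> * z) * F z"
      unfolding exp_add F_def by (simp only: mult_ac)
    also have "exp (of_real pi * \<i> * of_int (d - b - d * b)) = - 1"
    proof -
      have "odd b \<or> odd d" using det by (metis dvd_diff dvd_mult dvd_mult2 odd_one)
      then have "odd (d - b - d * b)" by auto
      then show ?thesis by (rule exp_pi_i_odd)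
    qed
    finally show ?thesis by simp
  qed
  have \<theta>1: "\<theta> (z + 1) = - \<theta> z" for z
    unfolding \<theta>_def by (rule theta_quot_shift_1)
  have \<theta>2: "\<theta> (z + \<tau>) = - exp (- of_real pi * \<i> * \<tau> - 2 * of_real pi * \<i> * z) * \<theta> z" for z
    unfolding \<theta>_def by (rule theta_quot_shift_tau[OF \<tau>])
  \<comment> \<open>The value \<open>1 / j\<close> at the zeros of \<open>\<theta>\<close> is the limit of \<open>F / \<theta>\<close> at \<open>0\<close>, by the derivatives of
    \<open>F\<close> and \<open>\<theta>\<close> there.\<close>
  define R where "R z = (if \<theta> z = 0 then 1 / j else F z / \<theta> z)" for z
  have R_per: "R (z + of_int m * \<tau> + of_int n) = R z" for z m n
    by (rule periodic_lattice) (simp_all add: R_def \<theta>1 \<theta>2 F1 F2)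
  have \<theta>0: "\<theta> 0 = 0" unfolding \<theta>_def by (rule theta_quot_0[OF \<tau>])
  have F0: "F 0 = 0" by (simp add: F_def theta_quot_0[OF \<tau>'])
  have \<theta>': "(\<theta> has_field_derivative - 2 * of_real pi * \<i>) (at 0)"
    unfolding \<theta>_def by (rule theta_quot_deriv_0[OF \<tau>])
  have F': "(F has_field_derivative - 2 * of_real pi * \<i> / j) (at 0)"
  proof -
    have "((\<lambda>z. theta_quot z \<tau>') has_field_derivative - 2 * of_real pi * \<i>) (at (0 / j))"
      using theta_quot_deriv_0[OF \<tau>'] by simp
    moreover have "((\<lambda>z. z / j) has_field_derivative 1 / j) (at 0)"
      using j by (auto intro!: derivative_eq_intros)
    ultimately have *: "((\<lambda>z. theta_quot (z / j) \<tau>') has_field_derivative - 2 * of_real pi * \<i> *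
        (1 / j)) (at 0)"
      by (rule DERIV_chain2)
    define G where "G z = exp (- of_real pi * \<i> * of_int c * z\<^sup>2 / j)" for z
    have "G holomorphic_on UNIV" unfolding G_def using j by (intro holomorphic_intros) auto
    then have "(G has_field_derivative deriv G 0) (at 0)" by (intro holomorphic_derivI) auto
    from DERIV_mult[OF * this] show ?thesis
      unfolding F_def G_def[symmetric] by (simp add: theta_quot_0[OF \<tau>'] G_def)
  qed
  obtain \<psi> where \<psi>: "\<psi> holomorphic_on UNIV" "\<psi> 0 = - 2 * of_real pi * \<i>" "\<And>z. \<theta> z = z * \<psi> z"
    using simple_zero_factor[OF \<theta>_hol \<theta>0 \<theta>'] by blast
  obtain \<phi> where \<phi>: "\<phi> holomorphic_on UNIV" "\<phi> 0 = - 2 * of_real pi * \<i> / j" "\<And>z. F z = z * \<phi> z"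
    using simple_zero_factor[OF F_hol F0 F'] by blast
  \<comment> \<open>The set \<open>U\<close> consists of \<open>0\<close> and the points off the lattice; periodicity transports
    differentiability from \<open>0\<close> to the other lattice points.\<close>
  define U where "U = {z. \<psi> z \<noteq> 0}"
  have "open U"
    unfolding U_def
    using \<psi>(1) by (intro open_Collect_neq holomorphic_on_imp_continuous_on) auto
  have "R z = \<phi> z / \<psi> z" if "z \<in> U" for z
    using that by (cases "z = 0") (auto simp: R_def U_def \<psi>(2,3) \<phi>(2,3))
  moreover have "(\<lambda>z. \<phi> z / \<psi> z) holomorphic_on U"
    by (intro holomorphic_intros holomorphic_on_subset[OF \<psi>(1)] holomorphic_on_subset[OF \<phi>(1)])
       (auto simp: U_def)
  ultimately have R_U: "R holomorphic_on U"
    by (metis (no_types, lifting) holomorphic_cong)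
  have R_hol: "R holomorphic_on UNIV"
  proof -
    have "R field_differentiable at z0" for z0
    proof (cases "\<theta> z0 = 0")
      case False
      then have "z0 \<in> U" by (auto simp: U_def \<psi>(3))
      then show ?thesis using R_U \<open>open U\<close> holomorphic_on_imp_differentiable_at by blast
    next
      case True
      then obtain m n where z0: "z0 = of_int m * \<tau> + of_int n"
        using theta_quot_eq_0_iff[OF \<tau>] by (auto simp: \<theta>_def)
      have "R field_differentiable at 0"
        using R_U \<open>open U\<close> by (rule holomorphic_on_imp_differentiable_at) (simp add: U_def \<psi>(2))
      then have "(R \<circ> (\<lambda>z. z - z0)) field_differentiable at z0"
        by (intro field_differentiable_compose derivative_intros) auto
      moreover have "R \<circ> (\<lambda>z. z - z0) = R"
      proof
        fix z show "(R \<circ> (\<lambda>z. z - z0)) z = R z"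
          using R_per[of "z - z0" m n] by (simp add: z0)
      qed
      ultimately show ?thesis by simp
    qed
    then show ?thesis by (simp add: holomorphic_on_def)
  qed
  have "R z = R 0"
    by (rule entire_doubly_periodic_imp_constant[OF \<tau> R_hol R_per])
  then have R: "R z = 1 / j" by (simp add: R_def \<theta>0)
  have "F z = \<theta> z / j"
  proof (cases "\<theta> z = 0")
    case False
    then show ?thesis using R j by (simp add: R_def field_simps)
  next
    case True
    then obtain m n where z: "z = of_int m * \<tau> + of_int n"
      using theta_quot_eq_0_iff[OF \<tau>] by (auto simp: \<theta>_def)
    have "z / j = of_int m * (\<tau> / j) + of_int n * (1 / j)" by (simp add: z add_divide_distrib)
    also have "\<dots> = of_int (m * d - n * c) * \<tau>' + of_int (n * a - m * b)"
      unfolding j1 j2 by (simp add: algebra_simps)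
    finally have "theta_quot (z / j) \<tau>' = 0"
      unfolding theta_quot_eq_0_iff[OF \<tau>'] by blast
    with True show ?thesis by (simp add: F_def)
  qed
  then have "F z * exp (of_real pi * \<i> * of_int c * z\<^sup>2 / j) = exp (of_real pi * \<i> * of_int c *
      z\<^sup>2 / j) / j * \<theta> z"
    by simp
  then show ?thesis
    unfolding F_def \<theta>_def \<tau>'_def by (simp add: mult.assoc exp_add[symmetric] del:
        times_divide_eq_left times_divide_eq_right)
qed

section \<open>Transformation laws of Klein forms\<close>

text \<open>
  In the variable \<open>z = s1 \<tau> + s2\<close> of the new characteristic, the argument on the left is
  \<open>z / (c \<tau> + d)\<close>. The exponential of \<open>z\<^sup>2\<close> from the theta quotient is absorbed by the prefactors
  \<open>exp (\<pi> \<i> r1 z / (c \<tau> + d))\<close> and \<open>exp (\<pi> \<i> s1 z)\<close>: this is the reason for the prefactor in the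
  Klein form.
\<close>

theorem klein_form_modular:
  fixes a b c d :: int
  assumes \<tau>: "Im \<tau> > 0" and det: "a * d - b * c = 1"
  shows "klein_form r1 r2 ((of_int a * \<tau> + of_int b) / (of_int c * \<tau> + of_int d)) =
     klein_form (r1 * of_int a + r2 * of_int c) (r1 * of_int b + r2 * of_int d) \<tau> / (of_int c *
         \<tau> + of_int d)"
proof -
  define j where "j = of_int c * \<tau> + of_int d"
  define s1 where "s1 = r1 * of_int a + r2 * of_int c"
  define s2 where "s2 = r1 * of_int b + r2 * of_int d"
  define z where "z = of_real s1 * \<tau> + of_real s2"
  define \<tau>' where "\<tau>' = (of_int a * \<tau> + of_int b) / j"
  have "c \<noteq> 0 \<or> d \<noteq> 0" using det by auto
  then have j: "j \<noteq> 0" unfolding j_def using moebius_denom_nonzero \<tau> by blast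
  have \<tau>': "Im \<tau>' > 0" unfolding \<tau>'_def j_def by (rule moebius_Im_pos[OF \<tau> det])
  have det': "of_int a * of_int d - of_int b * of_int c = (1 :: complex)"
    using det by (simp flip: of_int_mult of_int_diff)
  have z: "of_real r1 * \<tau>' + of_real r2 = z / j"
  proof -
    have "of_real r1 * \<tau>' + of_real r2 = (of_real r1 * (of_int a * \<tau> + of_int b) + of_real r2 *
        j) / j"
      using j by (simp add: \<tau>'_def field_simps)
    then show ?thesis by (simp add: z_def s1_def s2_def j_def algebra_simps)
  qed
  have "of_real s1 * j - of_int c * z = of_real r1 * (of_int a * of_int d - of_int b * of_int c)"
    by (simp add: j_def z_def s1_def s2_def algebra_simps)
  then have s1: "of_real r1 / j + of_int c * z / j = of_real s1"
    using j det' by (simp add: field_simps)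
  have "klein_form r1 r2 \<tau>' = exp (of_real pi * \<i> * of_real r1 * (z / j)) * theta_quot (z / j) \<tau>'"
    unfolding klein_form_eq[OF \<tau>'] z ..
  also have "theta_quot (z / j) \<tau>' = exp (of_real pi * \<i> * of_int c * z\<^sup>2 / j) / j * theta_quot z \<tau>"
    unfolding \<tau>'_def j_def by (rule theta_quot_modular[OF \<tau> det])
  also have "exp (of_real pi * \<i> * of_real r1 * (z / j)) * (exp (of_real pi * \<i> * of_int c *
      z\<^sup>2 / j) / j * theta_quot z \<tau>) =
     exp (of_real pi * \<i> * z * (of_real r1 / j + of_int c * z / j)) * theta_quot z \<tau> / j"
    by (simp add: exp_add ring_distribs power2_eq_square mult_ac)
  also have "\<dots> = klein_form s1 s2 \<tau> / j"
    unfolding s1 klein_form_eq[OF \<tau>] z_def[symmetric] by (simp only: mult_ac)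
  finally show ?thesis
    unfolding \<tau>'_def j_def s1_def s2_def .
qed

lemma klein_form_shift:
  fixes s1 s2 :: int
  assumes "Im \<tau> > 0"
  shows "klein_form (r1 + of_int s1) (r2 + of_int s2) \<tau> =
     exp (of_real pi * \<i> * of_real (of_int (s1 * s2 + s1 + s2) + r1 * of_int s2 - of_int s1 * r2)) *
     klein_form r1 r2 \<tau>"
proof -
  define z where "z = of_real r1 * \<tau> + of_real r2"
  have z': "of_real (r1 + of_int s1) * \<tau> + of_real (r2 + of_int s2) = z + of_int s1 * \<tau> + of_int s2"
    by (simp add: z_def algebra_simps)
  have "klein_form (r1 + of_int s1) (r2 + of_int s2) \<tau> =
      exp (of_real pi * \<i> * of_real (r1 + of_int s1) * (z + of_int s1 * \<tau> + of_int s2)) *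
      (exp (of_real pi * \<i> * (of_int (s1 + s2) - of_int s1 ^ 2 * \<tau> - 2 * of_int s1 * z)) *
          theta_quot z \<tau>)"
    unfolding klein_form_eq[OF assms] z' theta_quot_shift[OF assms] ..
  also have "\<dots> = exp (of_real pi * \<i> * of_real (of_int (s1 * s2 + s1 + s2) + r1 *
      of_int s2 - of_int s1 * r2)) *
     (exp (of_real pi * \<i> * of_real r1 * z) * theta_quot z \<tau>)"
    unfolding mult.assoc[symmetric] exp_add[symmetric]
    by (rule arg_cong[of _ _ "\<lambda>x. exp x * theta_quot z \<tau>"])
       (simp add: z_def algebra_simps power2_eq_square)
  finally show ?thesis
    unfolding klein_form_eq[OF assms] z_def .
qed

section \<open>Functions that are a power of q times a unit\<close>

text \<open>
  Zero-freeness is required on the whole unit disc, not only at \<open>0\<close>, so that negative powers remain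
  in the class.
\<close>

definition q_unit_expansion :: "nat \<Rightarrow> int \<Rightarrow> (complex \<Rightarrow> complex) \<Rightarrow> bool" where
  "q_unit_expansion h n f \<longleftrightarrow>
     (\<exists>G. G holomorphic_on ball 0 1 \<and> (\<forall>x\<in>ball 0 1. G x \<noteq> 0) \<and>
        (\<forall>\<tau>\<in>upper_half_plane. f \<tau> = qpow (of_int n / real h) \<tau> * G (qpow (1 / real h) \<tau>)))"

lemma q_unit_expansion_const:
  assumes "c \<noteq> 0"
  shows "q_unit_expansion h 0 (\<lambda>_. c)"
  unfolding q_unit_expansion_def
  using assms by (intro exI[of _ "\<lambda>_. c"]) (auto simp: qpow_def)

lemma q_unit_expansion_mult:
  assumes "q_unit_expansion h n f" "q_unit_expansion h n' f'"
  shows "q_unit_expansion h (n + n') (\<lambda>\<tau>. f \<tau> * f' \<tau>)"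
proof -
  from assms(1) obtain G where G: "G holomorphic_on ball 0 1" "\<And>x. x \<in> ball 0 1 \<Longrightarrow> G x \<noteq> 0"
    "\<And>\<tau>. \<tau> \<in> upper_half_plane \<Longrightarrow> f \<tau> = qpow (of_int n / real h) \<tau> * G (qpow (1 / real h) \<tau>)"
    unfolding q_unit_expansion_def by blast
  from assms(2) obtain G' where G': "G' holomorphic_on ball 0 1" "\<And>x. x \<in> ball 0 1 \<Longrightarrow> G' x \<noteq> 0"
    "\<And>\<tau>. \<tau> \<in> upper_half_plane \<Longrightarrow> f' \<tau> = qpow (of_int n' / real h) \<tau> * G' (qpow (1 / real h) \<tau>)"
    unfolding q_unit_expansion_def by blast
  show ?thesis
    unfolding q_unit_expansion_def
    by (intro exI[of _ "\<lambda>x. G x * G' x"])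
       (auto intro!: holomorphic_intros G(1) G'(1) simp: G(2,3) G'(2,3) add_divide_distrib qpow_add)
qed

lemma qpow_powi: "qpow s \<tau> powi n = qpow (of_int n * s) \<tau>"
  by (simp add: qpow_def exp_power_int mult_ac)

lemma q_unit_expansion_powi:
  assumes "q_unit_expansion h n f"
  shows "q_unit_expansion h (l * n) (\<lambda>\<tau>. f \<tau> powi l)"
proof -
  from assms(1) obtain G where G: "G holomorphic_on ball 0 1" "\<And>x. x \<in> ball 0 1 \<Longrightarrow> G x \<noteq> 0"
    "\<And>\<tau>. \<tau> \<in> upper_half_plane \<Longrightarrow> f \<tau> = qpow (of_int n / real h) \<tau> * G (qpow (1 / real h) \<tau>)"
    unfolding q_unit_expansion_def by blast
  show ?thesis
    unfolding q_unit_expansion_def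
    by (intro exI[of _ "\<lambda>x. G x powi l"])
       (auto intro!: holomorphic_intros G(1) simp: G(2,3) power_int_mult_distrib qpow_powi)
qed

lemma q_unit_expansion_prod:
  assumes "finite A" "\<And>t. t \<in> A \<Longrightarrow> q_unit_expansion h (n t) (f t)"
  shows "q_unit_expansion h (\<Sum>t\<in>A. n t) (\<lambda>\<tau>. \<Prod>t\<in>A. f t \<tau>)"
  using assms
  by (induction A rule: finite_induct)
     (auto intro!: q_unit_expansion_const q_unit_expansion_mult)

lemma q_unit_expansion_cong:
  assumes "q_unit_expansion h n f" "\<And>\<tau>. Im \<tau> > 0 \<Longrightarrow> f \<tau> = f' \<tau>"
  shows "q_unit_expansion h n f'"
  using assms unfolding q_unit_expansion_def upper_half_plane_def by auto

lemma q_unit_expansion_imp_holomorphic: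
  assumes "q_unit_expansion h n f" "h > 0"
  shows "f holomorphic_on upper_half_plane"
proof -
  from assms(1) obtain G where G: "G holomorphic_on ball 0 1"
    "\<And>\<tau>. \<tau> \<in> upper_half_plane \<Longrightarrow> f \<tau> = qpow (of_int n / real h) \<tau> * G (qpow (1 / real h) \<tau>)"
    unfolding q_unit_expansion_def by blast
  have qpow: "qpow s holomorphic_on A" for s A
    unfolding qpow_def by (intro holomorphic_intros)
  have "G \<circ> qpow (1 / real h) holomorphic_on upper_half_plane"
    using assms(2)
    by (intro holomorphic_on_compose_gen[OF qpow G(1)])
       (auto simp: upper_half_plane_def intro!: norm_qpow_less_1)
  then have "(\<lambda>\<tau>. qpow (of_int n / real h) \<tau> * G (qpow (1 / real h) \<tau>))
      holomorphic_on upper_half_plane"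
    by (intro holomorphic_intros qpow) (simp add: o_def)
  then show ?thesis
    using G(2) by (metis (no_types, lifting) holomorphic_cong)
qed

lemma holomorphic_on_unit_ball_has_sum:
  fixes G :: "complex \<Rightarrow> complex"
  assumes "G holomorphic_on ball 0 1" "norm x < 1"
  shows "((\<lambda>k. (deriv ^^ k) G 0 / fact k * x ^ k) has_sum G x) UNIV"
proof -
  have sums: "(\<lambda>k. (deriv ^^ k) G 0 / fact k * y ^ k) sums G y" if "norm y < 1" for y
    using holomorphic_power_series[OF assms(1), of y] that by simp
  obtain r where r: "norm x < r" "r < 1" using assms(2) dense by blast
  then have "norm (complex_of_real r) < 1" "norm x < norm (complex_of_real r)"
    using norm_ge_zero[of x] by (simp_all add: abs_if del: norm_ge_zero)
  then have "summable (\<lambda>k. norm ((deriv ^^ k) G 0 / fact k * x ^ k))"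
    using sums_summable[OF sums[of "of_real r"]] by (intro powser_insidea[of _ "of_real r"])
  then show ?thesis
    using sums[OF assms(2)] by (rule norm_summable_imp_has_sum)
qed

lemma q_unit_expansion_imp_has_ord_q:
  assumes "q_unit_expansion h n f" "h > 0"
  shows "has_ord_q f (of_int n / real h)"
proof -
  from assms(1) obtain G where G: "G holomorphic_on ball 0 1" "\<And>x. x \<in> ball 0 1 \<Longrightarrow> G x \<noteq> 0"
    "\<And>\<tau>. \<tau> \<in> upper_half_plane \<Longrightarrow> f \<tau> = qpow (of_int n / real h) \<tau> * G (qpow (1 / real h) \<tau>)"
    unfolding q_unit_expansion_def by blast
  define c where "c k = (deriv ^^ k) G 0 / fact k" for k
  define a where "a i = (if i < n then 0 else c (nat (i - n)))" for i
  have "((\<lambda>i. a i * qpow (real_of_int i / real h) \<tau>) has_sum f \<tau>) UNIV"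
      if "\<tau> \<in> upper_half_plane" for \<tau>
  proof -
    define x where "x = qpow (1 / real h) \<tau>"
    have "norm x < 1" unfolding x_def
      using that assms(2) by (intro norm_qpow_less_1) (auto simp: upper_half_plane_def)
    then have "((\<lambda>k. c k * x ^ k) has_sum G x) UNIV"
      unfolding c_def by (rule holomorphic_on_unit_ball_has_sum[OF G(1)])
    then have "((\<lambda>k. qpow (of_int n / real h) \<tau> * (c k * x ^ k)) has_sum f \<tau>) UNIV"
      unfolding G(3)[OF that] x_def[symmetric] by (rule has_sum_cmult_right)
    also have "(\<lambda>k. qpow (of_int n / real h) \<tau> * (c k * x ^ k)) =
        (\<lambda>i. a i * qpow (real_of_int i / real h) \<tau>) \<circ> (\<lambda>k. n + int k)"
    proof
      fix k
      have "x ^ k = qpow (real k / real h) \<tau>"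
        using qpow_powi[of "1 / real h" \<tau> "int k"] by (simp add: x_def)
      then show "qpow (of_int n / real h) \<tau> * (c k * x ^ k) =
         ((\<lambda>i. a i * qpow (real_of_int i / real h) \<tau>) \<circ> (\<lambda>k. n + int k)) k"
        by (simp add: a_def add_divide_distrib qpow_add)
    qed
    also have "(\<dots> has_sum f \<tau>) UNIV \<longleftrightarrow>
        ((\<lambda>i. a i * qpow (real_of_int i / real h) \<tau>) has_sum f \<tau>) (range (\<lambda>k. n + int k))"
      by (rule has_sum_reindex[symmetric]) (auto intro: injI)
    also have "\<dots> \<longleftrightarrow> ((\<lambda>i. a i * qpow (real_of_int i / real h) \<tau>) has_sum f \<tau>) UNIV"
    proof (rule has_sum_cong_neutral)
      fix i assume "i \<in> UNIV - range (\<lambda>k. n + int k)"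
      moreover have "i = n + int (nat (i - n))" if "i \<ge> n" using that by simp
      ultimately have "i < n" by (metis DiffD2 not_le rangeI)
      then show "a i * qpow (real_of_int i / real h) \<tau> = 0" by (simp add: a_def)
    qed auto
    finally show ?thesis .
  qed
  moreover have "finite {i. i < 0 \<and> a i \<noteq> 0}"
    by (rule finite_subset[of _ "{n..<0}"]) (auto simp: a_def)
  ultimately have "has_q_expansion f h a"
    using assms(2) unfolding has_q_expansion_def by blast
  moreover have "a n \<noteq> 0" using G(2)[of 0] by (simp add: a_def c_def)
  moreover have "\<forall>i<n. a i = 0" by (simp add: a_def)
  ultimately show ?thesis unfolding has_ord_q_def by blast
qed

text \<open>
  The argument is \<open>\<sigma> = (g \<tau> + y) / (N / g)\<close> and \<open>x = q\<^bsup>1/(2N)\<^esup>\<close>. Up to factors of absolute value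
  \<open>1\<close>, the nome of \<open>\<sigma>\<close> is \<open>x\<^bsup>2g\<^sup>2\<^esup>\<close>, the exponential of \<open>z\<close> is \<open>x\<^bsup>2gj\<^esup>\<close>, and their quotient is
  \<open>x\<^bsup>2g(g-j)\<^esup>\<close>. Since \<open>0 \<le> j < g\<close>, these exponents are nonnegative, so the product formula
  converges and has no zeros on the unit disc. If \<open>j = 0\<close>, the factor \<open>1 - W x\<close> is the constant
  \<open>1 - exp (2 \<pi> \<i> r)\<close>, and the condition on \<open>r\<close> keeps it away from \<open>0\<close>.
\<close>

lemma q_unit_expansion_klein_form:
  fixes N g j :: nat and y :: int and r :: real
  assumes "N > 0" "j < g" and r: "j = 0 \<Longrightarrow> r \<notin> \<int>"
  shows "q_unit_expansion (2 * N) (int j * (int j - int g))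
     (\<lambda>\<tau>. klein_form (real j / real g) r (of_nat g * (of_nat g * \<tau> + of_int y) / of_nat N))"
proof -
  define e where "e x = exp (2 * of_real pi * \<i> * of_real x)" for x
  have e_norm: "norm (e x) = 1" for x by (simp add: e_def norm_exp_eq_Re)
  define \<beta> where "\<beta> = e (g * y / N)"
  define \<delta> where "\<delta> = e (j * y / N + r)"
  define Q where "Q x = \<beta> * x ^ (2 * g * g)" for x
  define W where "W x = \<delta> * x ^ (2 * g * j)" for x
  define W' where "W' x = \<beta> / \<delta> * x ^ (2 * g * (g - j))" for x
  define G where "G x = e ((j / g - 1) / 2 * (j * y / N + r)) * q_pochhammer (Q x) (W x) *
      q_pochhammer (Q x) (W' x) / (q_pochhammer (Q x) (Q x))\<^sup>2" for x
  have less_1: "norm (x ^ l) < 1" if "x \<in> ball 0 1" "l > 0" for x :: complex and l :: nat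
    using that by (simp add: norm_power power_less_one_iff)
  have Q1: "norm (Q x) < 1" if "x \<in> ball 0 1" for x
    using less_1[OF that, of "2 * g * g"] assms(2) by (simp add: Q_def \<beta>_def norm_mult e_norm)
  have W'1: "norm (W' x) < 1" if "x \<in> ball 0 1" for x
    using less_1[OF that, of "2 * g * (g - j)"] assms(2)
    by (simp add: W'_def \<beta>_def \<delta>_def norm_mult norm_divide e_norm)
  have W1: "norm (W x) \<le> 1 \<and> W x \<noteq> 1" if "x \<in> ball 0 1" for x
  proof (cases "j = 0")
    case True
    have "\<delta> \<noteq> 1"
    proof
      assume "\<delta> = 1"
      then obtain l :: int where "2 * pi * r = of_int (2 * l) * pi"
        using True by (auto simp: \<delta>_def e_def exp_eq_1)
      then have "r = of_int l" by simp
      then show False using r True by auto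
    qed
    then show ?thesis using True by (simp add: W_def) (simp add: \<delta>_def e_norm)
  next
    case False
    then have "norm (W x) < 1"
      using less_1[OF that, of "2 * g * j"] assms(2) by (simp add: W_def \<delta>_def norm_mult e_norm)
    then show ?thesis by auto
  qed
  have QQ: "q_pochhammer (Q x) (Q x) \<noteq> 0" if "x \<in> ball 0 1" for x
    using Q1[OF that] by (intro q_pochhammer_nonzero) auto
  have "G holomorphic_on ball 0 1"
    unfolding G_def
    by (intro holomorphic_intros holomorphic_q_pochhammer Q1)
       (auto simp: Q_def W_def W'_def QQ[unfolded Q_def] intro!: holomorphic_intros)
  moreover have "G x \<noteq> 0" if "x \<in> ball 0 1" for x
  proof -
    have "q_pochhammer (Q x) (W x) \<noteq> 0" using Q1 W1 that by (intro q_pochhammer_nonzero) auto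
    moreover have "q_pochhammer (Q x) (W' x) \<noteq> 0" using Q1[OF that] W'1[OF that]
        by (intro q_pochhammer_nonzero) auto
    ultimately show ?thesis using QQ[OF that] by (simp add: G_def e_def)
  qed
  moreover have "klein_form (real j / real g) r (of_nat g * (of_nat g * \<tau> + of_int y) / of_nat N) =
      qpow (of_int (int j * (int j - int g)) / real (2 * N)) \<tau> * G (qpow (1 / real (2 * N)) \<tau>)"
    if \<tau>: "\<tau> \<in> upper_half_plane" for \<tau>
  proof -
    define \<sigma> where "\<sigma> = of_nat g * (of_nat g * \<tau> + of_int y) / of_nat N"
    define x where "x = qpow (1 / real (2 * N)) \<tau>"
    define z where "z = of_real (real j / real g) * \<sigma> + of_real r"
    have "Im \<sigma> = real g * real g * Im \<tau> / real N"
      unfolding \<sigma>_def by simp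
    then have \<sigma>: "Im \<sigma> > 0" using \<tau> assms by (simp add: upper_half_plane_def)
    have x: "x ^ l = exp (of_real pi * \<i> * of_nat l * \<tau> / of_nat N)" for l
      unfolding x_def qpow_def exp_of_nat_mult[symmetric] using assms(1) by (simp add: field_simps)
    have z: "z = of_nat (g * j) * \<tau> / of_nat N + of_real (j * y / N + r)"
      unfolding z_def \<sigma>_def using assms by (simp add: field_simps)
    have 1: "qpow 1 \<sigma> = Q x"
      unfolding Q_def x \<beta>_def e_def qpow_def exp_add[symmetric] \<sigma>_def
      by (rule arg_cong[of _ _ exp]) (use assms in \<open>simp add: field_simps\<close>)
    have 2: "exp (2 * of_real pi * \<i> * z) = W x"
      unfolding W_def x \<delta>_def e_def exp_add[symmetric] z
      by (rule arg_cong[of _ _ exp]) (use assms in \<open>simp add: field_simps\<close>)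
    have 3: "Q x / W x = W' x"
    proof -
      have "2 * g * g = 2 * g * (g - j) + 2 * g * j"
        using assms(2) by (simp add: algebra_simps flip: distrib_left mult.assoc)
      then have "x ^ (2 * g * g) = x ^ (2 * g * (g - j)) * x ^ (2 * g * j)"
        by (metis power_add)
      moreover have "x \<noteq> 0" "\<delta> \<noteq> 0" by (simp_all add: x_def \<delta>_def e_def)
      ultimately show ?thesis by (simp add: Q_def W_def W'_def)
    qed
    have 4: "exp (of_real pi * \<i> * of_real (real j / real g) * z) * exp (- of_real pi * \<i> * z) =
       qpow (of_int (int j * (int j - int g)) / real (2 * N)) \<tau> * e ((j / g - 1) / 2 * (j *
           y / N + r))"
      unfolding z e_def qpow_def exp_add[symmetric]
      by (rule arg_cong[of _ _ exp]) (use assms in \<open>simp add: field_simps\<close>)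
    have "klein_form (real j / real g) r \<sigma> =
       exp (of_real pi * \<i> * of_real (real j / real g) * z) *
       (exp (- of_real pi * \<i> * z) * q_pochhammer (Q x) (W x) * q_pochhammer (Q x) (W' x)
           / (q_pochhammer (Q x) (Q x))\<^sup>2)"
      unfolding klein_form_eq[OF \<sigma>] z_def[symmetric] theta_quot_def Let_def 1 2 3 ..
    also have "\<dots> = (exp (of_real pi * \<i> * of_real (real j / real g) * z) * exp (- of_real pi *
        \<i> * z)) *
        (q_pochhammer (Q x) (W x) * q_pochhammer (Q x) (W' x) / (q_pochhammer (Q x) (Q x))\<^sup>2)"
      by simp
    also have "\<dots> = qpow (of_int (int j * (int j - int g)) / real (2 * N)) \<tau> * G x"
      unfolding 4 G_def by simp
    finally show ?thesis unfolding \<sigma>_def x_def .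
  qed
  ultimately show ?thesis
    unfolding q_unit_expansion_def by blast
qed

section \<open>The slashed product of Klein forms\<close>

lemma SL2Z_det:
  assumes "A \<in> SL2Z"
  shows "A $ 1 $ 1 * A $ 2 $ 2 - A $ 1 $ 2 * A $ 2 $ 1 = 1"
  using assms by (simp add: SL2Z_def det_2)

lemma prod_power_int:
  fixes x :: "'a :: field"
  assumes "x \<noteq> 0" "finite A"
  shows "(\<Prod>t\<in>A. x powi m t) = x powi (\<Sum>t\<in>A. m t)"
  using assms(2) by (induction A rule: finite_induct) (simp_all add: assms(1) power_int_add)

text \<open>
  Each Klein form contributes a factor \<open>(c \<tau> + d)\<^bsup>-1\<^esup>\<close>, so the product has weight \<open>-\<Sum> m(t)\<close>; the
  values \<open>C t\<close> are what remains of the single factors.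
\<close>

lemma slash_klein_product:
  fixes A :: "int ^ 2 ^ 2" and m :: "nat \<Rightarrow> int"
  defines "j \<equiv> \<lambda>\<tau>. of_int (A $ 2 $ 1) * \<tau> + of_int (A $ 2 $ 2)"
  assumes "A \<in> SL2Z" "Im \<tau> > 0" and k: "k = - (\<Sum>t = 1..N - 1. m t)"
    and C: "\<And>t. t \<in> {1..N - 1} \<Longrightarrow>
      klein_form (real t / real N) 0
        (of_nat N * ((of_int (A $ 1 $ 1) * \<tau> + of_int (A $ 1 $ 2)) / j \<tau>)) = C t / j \<tau>"
  shows "slash k A (klein_product N m) \<tau> = (\<Prod>t = 1..N - 1. C t powi m t)"
proof -
  have "A $ 2 $ 1 \<noteq> 0 \<or> A $ 2 $ 2 \<noteq> 0" using SL2Z_det[OF assms(2)] by auto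
  then have j: "j \<tau> \<noteq> 0" unfolding j_def using moebius_denom_nonzero assms(3) by blast
  have "klein_product N m ((of_int (A $ 1 $ 1) * \<tau> + of_int (A $ 1 $ 2)) / j \<tau>) =
     (\<Prod>t = 1..N - 1. (C t / j \<tau>) powi m t)"
    unfolding klein_product_def by (intro prod.cong refl) (simp only: C)
  also have "\<dots> = (\<Prod>t = 1..N - 1. C t powi m t) / j \<tau> powi (\<Sum>t = 1..N - 1. m t)"
    by (simp add: power_int_divide_distrib prod_dividef prod_power_int j)
  moreover have "slash k A (klein_product N m) \<tau> = j \<tau> powi (\<Sum>t = 1..N - 1. m t) *
     klein_product N m ((of_int (A $ 1 $ 1) * \<tau> + of_int (A $ 1 $ 2)) / j \<tau>)"
    by (simp add: slash_def j_def k)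
  ultimately show ?thesis using j by simp
qed

lemma frac_divide_of_int:
  assumes "g > 0"
  shows "frac (real_of_int x / real_of_int g) = real_of_int (x mod g) / real_of_int g"
proof -
  have "real_of_int x = real_of_int (x div g) * of_int g + of_int (x mod g)"
    by (simp flip: of_int_mult of_int_add)
  then have "real_of_int x / real_of_int g = real_of_int (x div g) + of_int (x mod g) / of_int g"
    using assms by (metis add_divide_distrib nonzero_mult_div_cancel_right of_int_0_eq_iff
        order_less_irrefl)
  moreover have "\<lfloor>real_of_int x / real_of_int g\<rfloor> = x div g" by (rule floor_divide_of_int_eq)
  ultimately show ?thesis unfolding frac_def by linarith
qed

text \<open>
  Writing matrices by rows, \<open>diag(N, 1) \<alpha> = (aN', u; c', v) (g, y; 0, N')\<close> with \<open>c = g c'\<close> and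
  \<open>N = g N'\<close>. The second row requires \<open>c y + N v = g d\<close>, which is solved by Bezout's identity; the
  first row then gives \<open>u\<close>, and comparing determinants shows that the first factor lies in
  \<open>SL\<^sub>2(\<int>)\<close>. It sends the characteristic \<open>(t/N, 0)\<close> to \<open>(at/g, tu/N)\<close>. The two entries are not both
  integers, as the matrix is invertible over \<open>\<int>\<close> and \<open>0 < t < N\<close>; this is the condition for the
  unit expansion. Reducing \<open>at/g\<close> modulo \<open>1\<close> costs only the constant \<open>\<epsilon> t\<close>.
\<close>

lemma q_unit_expansion_slash_klein_product:
  fixes A :: "int ^ 2 ^ 2" and m :: "nat \<Rightarrow> int"
  assumes A: "A \<in> SL2Z" and N: "N \<ge> 2" and k: "k = - (\<Sum>t = 1..N - 1. m t)"
  defines "g \<equiv> gcd (A $ 2 $ 1) (int N)"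
  defines "r \<equiv> \<lambda>t. (A $ 1 $ 1 * int t) mod g"
  shows "q_unit_expansion (2 * N) (\<Sum>t = 1..N - 1. m t * (r t * (r t - g)))
      (slash k A (klein_product N m))"
proof -
  define a b c d where "a = A $ 1 $ 1" and "b = A $ 1 $ 2" and "c = A $ 2 $ 1" and "d = A $ 2 $ 2"
  have det: "a * d - b * c = 1" unfolding a_def b_def c_def d_def using A by (rule SL2Z_det)
  have g_pos: "g > 0" using N by (simp add: g_def)
  obtain c' where c': "c = g * c'" unfolding g_def c_def by (meson dvdE gcd_dvd1)
  obtain N' where N': "int N = g * N'" unfolding g_def by (meson dvdE gcd_dvd2)
  have N'_pos: "N' > 0" using N' g_pos N
      by (metis of_nat_0_less_iff less_le_trans zero_less_numeral zero_less_mult_pos)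
  obtain u0 v0 where uv: "u0 * c + v0 * int N = g"
    unfolding g_def c_def using bezout_int by blast
  define y v where "y = u0 * d" and "v = v0 * d"
  have "c * y + int N * v = (u0 * c + v0 * int N) * d"
    by (simp add: y_def v_def algebra_simps)
  then have yv: "c * y + int N * v = g * d" by (simp add: uv)
  define u where "u = g * b - a * y"
  have "g * (a * N' * v - u * c') = a * (c * y + int N * v) - g * b * c"
    unfolding N' u_def c' by (simp add: algebra_simps)
  also have "\<dots> = g * (a * d - b * c)" unfolding yv by (simp add: algebra_simps)
  finally have det': "(a * N') * v - u * c' = 1" using g_pos det by simp
  have r_bounds: "0 \<le> r t" "r t < g" for t using g_pos by (auto simp: r_def)
  have r_real: "real t * of_int a / of_int g = of_int (r t) / of_int g + real_of_int (a *
      int t div g)" for t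
  proof -
    have "a * int t = (a * int t div g) * g + r t" by (simp add: r_def a_def)
    then have "real_of_int (a * int t) = real_of_int ((a * int t div g) * g + r t)" by simp
    then show ?thesis using g_pos by (simp add: field_simps)
  qed
  define \<sigma> where "\<sigma> \<tau> = of_int g * (of_int g * \<tau> + of_int y) / of_nat N" for \<tau> :: complex
  define \<epsilon> where "\<epsilon> t = exp (of_real pi * \<i> * of_real (of_int (a * int t div g) -
      of_int (a * int t div g) * (real t / real N * real_of_int u)))" for t
  have \<epsilon>0: "\<epsilon> t \<noteq> 0" for t by (simp add: \<epsilon>_def)
  define K where "K t \<tau> = of_int N' * \<epsilon> t * klein_form (of_int (r t) / of_int g)
      (real t / real N * real_of_int u) (\<sigma> \<tau>)" for t \<tau>
  have \<sigma>: "Im (\<sigma> \<tau>) > 0" if "Im \<tau> > 0" for \<tau>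
    using that N g_pos by (simp add: \<sigma>_def)
  have N'c: "of_nat N = of_int g * (of_int N' :: complex)"
    using arg_cong[OF N', of "of_int :: int \<Rightarrow> complex"] by simp
  have N'r: "real N = of_int g * of_int N'"
    using arg_cong[OF N', of real_of_int] by simp
  have slash: "slash k A (klein_product N m) \<tau> = (\<Prod>t = 1..N - 1. K t \<tau> powi m t)" if \<tau>:
      "Im \<tau> > 0" for \<tau>
  proof (rule slash_klein_product[OF A \<tau> k])
    fix t assume "t \<in> {1..N - 1}"
    define J where "J = of_int c * \<tau> + of_int d"
    have "c \<noteq> 0 \<or> d \<noteq> 0" using det by auto
    then have J: "J \<noteq> 0" unfolding J_def using moebius_denom_nonzero \<tau> by blast
    have yvc: "of_int c * of_int y + of_nat N * of_int v = of_int g * (of_int d :: complex)"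
      using arg_cong[OF yv, of "of_int :: int \<Rightarrow> complex"] by simp
    have gc: "of_int g * of_int c' = (of_int c :: complex)" using c' by simp
    have nz: "of_int g \<noteq> (0 :: complex)" "of_int N' \<noteq> (0 :: complex)" using g_pos N'_pos by auto
    have \<sigma>': "\<sigma> \<tau> = (of_int g * \<tau> + of_int y) / of_int N'"
      using nz by (simp add: \<sigma>_def N'c field_simps)
    have den: "of_int c' * \<sigma> \<tau> + of_int v = J / of_int N'"
    proof -
      have "of_int g * (of_int c' * \<sigma> \<tau> + of_int v) = 
         (of_int c * (of_int g * \<tau>) + (of_int c * of_int y + of_nat N * of_int v)) / of_int N'"
        unfolding \<sigma>' N'c gc[symmetric] using nz by (simp add: field_simps)
      also have "\<dots> = of_int g * (J / of_int N')"
        unfolding yvc J_def by (simp add: field_simps)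
      finally show ?thesis by (simp only: mult_left_cancel[OF nz(1)])
    qed
    have num: "of_int (a * N') * \<sigma> \<tau> + of_int u = of_int g * (of_int a * \<tau> + of_int b)"
      unfolding \<sigma>' u_def using nz by (simp add: field_simps)
    have arg: "of_nat N * ((of_int a * \<tau> + of_int b) / J) =
        (of_int (a * N') * \<sigma> \<tau> + of_int u) / (of_int c' * \<sigma> \<tau> + of_int v)"
      unfolding num den N'c using nz J by (simp add: field_simps)
    have "klein_form (real t / real N) 0 (of_nat N * ((of_int a * \<tau> + of_int b) / J)) =
       klein_form (real t / real N * of_int (a * N')) (real t / real N * of_int u) (\<sigma> \<tau>)
           / (J / of_int N')"
      unfolding arg klein_form_modular[OF \<sigma>[OF \<tau>] det'] by (simp only:
          den mult_zero_left add_0_right)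
    also have "real t / real N * of_int (a * N') = of_int (r t) / of_int g + of_int (a *
        int t div g)"
      using r_real[of t] g_pos N'_pos by (simp add: N'r field_simps)
    also have "klein_form (of_int (r t) / of_int g + of_int (a * int t div g))
        (real t / real N * of_int u) (\<sigma> \<tau>) =
        \<epsilon> t * klein_form (of_int (r t) / of_int g) (real t / real N * real_of_int u) (\<sigma> \<tau>)"
      using klein_form_shift[OF \<sigma>[OF \<tau>], of "of_int (r t) / of_int g" "a * int t div g"
          "real t / real N * of_int u" 0]
      by (simp add: \<epsilon>_def)
    finally show "klein_form (real t / real N) 0
        (of_nat N * ((of_int (A $ 1 $ 1) * \<tau> + of_int (A $ 1 $ 2)) / (of_int (A $ 2 $ 1) * \<tau> +
            of_int (A $ 2 $ 2)))) =
        K t \<tau> / (of_int (A $ 2 $ 1) * \<tau> + of_int (A $ 2 $ 2))"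
      unfolding a_def[symmetric] b_def[symmetric] c_def[symmetric] d_def[symmetric]
          J_def[symmetric] K_def
      by (simp add: field_simps)
  qed
  have K: "q_unit_expansion (2 * N) (r t * (r t - g)) (K t)" if t: "t \<in> {1..N - 1}" for t
  proof -
    have *: "real t / real N * real_of_int u \<notin> \<int>" if "nat (r t) = 0"
    proof
      assume "real t / real N * real_of_int u \<in> \<int>"
      then obtain l where "real t / real N * real_of_int u = of_int l" by (auto elim: Ints_cases)
      then have "real t * of_int u = of_int l * real N" using N by (simp add: field_simps)
      then have 1: "int t * u = l * int N" 
        by (metis of_int_eq_iff of_int_mult of_int_of_nat_eq)
      have "r t = 0" using that r_bounds[of t] by simp
      then have "g dvd a * int t" by (auto simp: r_def a_def)
      then obtain l' where l': "a * int t = g * l'" by blast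
      have "int t = int t * (a * N' * v - u * c')" using det' by simp
      also have "\<dots> = (a * int t) * N' * v - (int t * u) * c'" by (simp add: algebra_simps)
      also have "\<dots> = int N * (l' * v - l * c')"
        unfolding 1 l' N' by (simp add: algebra_simps)
      finally have "int N dvd int t" by simp
      then show False using t N by (auto dest!: dvd_imp_le)
    qed
    have "q_unit_expansion (2 * N) (int (nat (r t)) * (int (nat (r t)) - int (nat g)))
     (\<lambda>\<tau>. klein_form (real (nat (r t)) / real (nat g)) (real t / real N * real_of_int u)
         (of_nat (nat g) * (of_nat (nat g) * \<tau> + of_int y) / of_nat N))"
      by (rule q_unit_expansion_klein_form) (use N r_bounds[of t] * in auto)
    then have "q_unit_expansion (2 * N) (r t * (r t - g))
        (\<lambda>\<tau>. klein_form (of_int (r t) / of_int g) (real t / real N * real_of_int u) (\<sigma> \<tau>))"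
      unfolding \<sigma>_def using r_bounds[of t] g_pos by simp
    from q_unit_expansion_mult[OF q_unit_expansion_const this, of "of_int N' * \<epsilon> t"] show ?thesis
      unfolding K_def using N'_pos \<epsilon>0 by simp
  qed
  have "q_unit_expansion (2 * N) (\<Sum>t = 1..N - 1. m t * (r t * (r t - g)))
     (\<lambda>\<tau>. \<Prod>t = 1..N - 1. K t \<tau> powi m t)"
    by (intro q_unit_expansion_prod q_unit_expansion_powi K) auto
  then show ?thesis
    by (rule q_unit_expansion_cong) (simp add: slash)
qed

text \<open>
  For even \<open>N\<close> the congruence makes \<open>S\<close>, hence \<open>T\<close>, even. For odd \<open>N\<close> the numbers \<open>S\<close>, \<open>T\<close> and \<open>u\<close>
  have the same parity, so the claim is that \<open>u A (b + 1)\<close> is even: if \<open>A\<close> is odd, then the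
  diagonal entry \<open>1 + A N\<close> is even and the determinant forces \<open>b\<close> to be odd.
\<close>

lemma Gamma1_sign_even:
  fixes A b d S T :: int
  assumes "N > 0" and det: "(1 + A * N) * d - b * c * N = 1"
    and S: "S = gcd 2 N * N * u" and T: "even (S - T)"
  shows "even (A * b * S + (A + b) * T + b * (gcd 2 N * u))"
proof (cases "even N")
  case True
  then have "gcd 2 N = 2" by (simp add: gcd_proj1_iff)
  then show ?thesis using S T by auto
next
  case False
  then have g: "gcd 2 N = 1" using coprime_commute
      by (metis coprime_iff_gcd_eq_1 coprime_right_2_iff_odd gcd.commute)
  have "odd ((1 + A * N) * d - b * c * N)" unfolding det by simp
  then show ?thesis using False T S by (auto simp: g)
qed

text \<open>
  Conjugation by \<open>diag(N, 1)\<close> turns \<open>A\<close> into an integral matrix with first row \<open>(1 + eN, bN)\<close>,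
  which moves the characteristic \<open>(t/N, 0)\<close> by the integral vector \<open>(et, bt)\<close>. The shift
  contributes the factor \<open>exp (\<pi> \<i> X t)\<close>, and after weighting by \<open>m t\<close> the sum of the \<open>X t\<close> is an
  even integer.
\<close>

lemma slash_Gamma1_klein_product:
  fixes m :: "nat \<Rightarrow> int"
  assumes A: "A \<in> Gamma1 N" and N: "N \<ge> 2" and k: "k = - (\<Sum>t = 1..N - 1. m t)"
    and S: "[(\<Sum>t = 1..N - 1. m t * int t ^ 2) = 0] (mod (gcd 2 (int N) * int N))"
    and \<tau>: "Im \<tau> > 0"
  shows "slash k A (klein_product N m) \<tau> = klein_product N m \<tau>"
proof -
  define b d where "b = A $ 1 $ 2" and "d = A $ 2 $ 2"
  have ASL: "A \<in> SL2Z" using A by (simp add: Gamma1_def)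
  obtain e where e: "A $ 1 $ 1 = 1 + e * int N"
  proof -
    have "int N dvd A $ 1 $ 1 - 1" using A by (simp add: Gamma1_def cong_iff_dvd_diff)
    then obtain e where "A $ 1 $ 1 - 1 = int N * e" by (elim dvdE)
    then show thesis by (intro that[of e]) (simp add: algebra_simps)
  qed
  obtain c where c: "A $ 2 $ 1 = c * int N"
  proof -
    have "int N dvd A $ 2 $ 1" using A by (simp add: Gamma1_def cong_0_iff)
    then obtain c where "A $ 2 $ 1 = int N * c" by (elim dvdE)
    then show thesis by (intro that[of c]) (simp add: mult.commute)
  qed
  obtain u where u: "(\<Sum>t = 1..N - 1. m t * int t ^ 2) = gcd 2 (int N) * int N * u"
    using S unfolding cong_0_iff by (elim dvdE)
  have det: "(1 + e * int N) * d - b * c * int N = 1"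
    using SL2Z_det[OF ASL] unfolding b_def d_def e c by (simp add: mult_ac)
  define X where "X t = real_of_int (e * b * int t ^ 2 + (e + b) * int t) + real t ^ 2 *
      of_int b / real N" for t
  define E where "E t = exp (of_real pi * \<i> * of_real (X t))" for t
  have "slash k A (klein_product N m) \<tau> =
     (\<Prod>t = 1..N - 1. (E t * klein_form (real t / real N) 0 (of_nat N * \<tau>)) powi m t)"
  proof (rule slash_klein_product[OF ASL \<tau> k])
    fix t
    define J where "J = of_int (A $ 2 $ 1) * \<tau> + of_int (A $ 2 $ 2)"
    have \<tau>N: "Im (of_nat N * \<tau>) > 0" using \<tau> N by simp
    have det': "(1 + e * int N) * d - (b * int N) * c = 1" using det by (simp add: mult_ac)
    have J: "of_int c * (of_nat N * \<tau>) + of_int d = J"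
      by (simp add: J_def c d_def)
    have arg: "of_nat N * ((of_int (A $ 1 $ 1) * \<tau> + of_int (A $ 1 $ 2)) / J) =
      (of_int (1 + e * int N) * (of_nat N * \<tau>) + of_int (b * int N)) / (of_int c * (of_nat N *
          \<tau>) + of_int d)"
      unfolding J e b_def[symmetric] by (simp add: algebra_simps)
    have "klein_form (real t / real N) 0 (of_nat N * ((of_int (A $ 1 $ 1) * \<tau> +
        of_int (A $ 1 $ 2)) / J)) =
       klein_form (real t / real N * of_int (1 + e * int N)) (real t / real N * of_int (b *
           int N)) (of_nat N * \<tau>) / J"
      unfolding arg klein_form_modular[OF \<tau>N det'] by (simp only: J mult_zero_left add_0_right)
    also have "real t / real N * of_int (1 + e * int N) = real t / real N + of_int (e * int t)"
      using N by (simp add: field_simps)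
    also have "real t / real N * of_int (b * int N) = 0 + of_int (b * int t)"
      using N by (simp add: field_simps)
    also have "klein_form (real t / real N + of_int (e * int t)) (0 + of_int (b * int t))
        (of_nat N * \<tau>) =
        E t * klein_form (real t / real N) 0 (of_nat N * \<tau>)"
      unfolding klein_form_shift[OF \<tau>N] E_def X_def
      by (rule arg_cong[of _ _ "\<lambda>x. exp (of_real pi * \<i> * of_real x) *
          klein_form (real t / real N) 0 (of_nat N * \<tau>)"])
         (simp add: algebra_simps power2_eq_square)
    finally show "klein_form (real t / real N) 0
        (of_nat N * ((of_int (A $ 1 $ 1) * \<tau> + of_int (A $ 1 $ 2)) / (of_int (A $ 2 $ 1) * \<tau> +
            of_int (A $ 2 $ 2)))) =
        E t * klein_form (real t / real N) 0 (of_nat N * \<tau>) / (of_int (A $ 2 $ 1) * \<tau> +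
            of_int (A $ 2 $ 2))"
      unfolding J_def .
  qed
  also have "\<dots> = (\<Prod>t = 1..N - 1. E t powi m t) * klein_product N m \<tau>"
    by (simp add: klein_product_def power_int_mult_distrib prod.distrib)
  also have "(\<Prod>t = 1..N - 1. E t powi m t) = exp (\<Sum>t = 1..N - 1. of_real pi * \<i> *
      of_real (of_int (m t) * X t))"
    by (simp add: exp_sum E_def exp_power_int mult_ac)
  also have "(\<Sum>t = 1..N - 1. of_real pi * \<i> * of_real (of_int (m t) * X t)) =
      of_real pi * \<i> * of_real (\<Sum>t = 1..N - 1. of_int (m t) * X t)"
    by (simp add: sum_distrib_left)
  also have "(\<Sum>t = 1..N - 1. of_int (m t) * X t) = 
     of_int (e * b * (\<Sum>t = 1..N - 1. m t * int t ^ 2) + (e + b) * (\<Sum>t = 1..N - 1. m t * int t)) 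
       + of_int b * of_int (\<Sum>t = 1..N - 1. m t * int t ^ 2) / real N"
    by (simp add: X_def sum_distrib_left sum_divide_distrib sum.distrib[symmetric] field_simps)
  also have "of_int b * of_int (\<Sum>t = 1..N - 1. m t * int t ^ 2) / real N = real_of_int (b *
      (gcd 2 (int N) * u))"
    unfolding u using N by simp
  finally have *: "slash k A (klein_product N m) \<tau> = exp (of_real pi * \<i> * of_int (e * b * (\<Sum>t =
      1..N - 1. m t * int t ^ 2) +
        (e + b) * (\<Sum>t = 1..N - 1. m t * int t) + b * (gcd 2 (int N) * u))) * klein_product N m \<tau>"
    by (simp only: of_int_add of_real_add of_real_of_int_eq)
  have "even ((\<Sum>t = 1..N - 1. m t * int t ^ 2) - (\<Sum>t = 1..N - 1. m t * int t))"
    unfolding sum_subtractf[symmetric] by (intro dvd_sum) auto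
  then have "even (e * b * (\<Sum>t = 1..N - 1. m t * int t ^ 2) +
        (e + b) * (\<Sum>t = 1..N - 1. m t * int t) + b * (gcd 2 (int N) * u))"
    using N by (intro Gamma1_sign_even[OF _ det u]) auto
  then show ?thesis
    unfolding * by (simp only: exp_pi_i_even mult_1_left)
qed

theorem theorem2p6:
  fixes N :: nat and m :: "nat \<Rightarrow> int" and k :: int
  assumes "N \<ge> 2"
    and "k = - (\<Sum>t = 1..N - 1. m t)"
  shows "([(\<Sum>t = 1..N - 1. m t * int t ^ 2) = 0] (mod (gcd 2 (int N) * int N)) \<longrightarrow>
           nearly_holomorphic_modular_form (Gamma1 N) k (klein_product N m)) \<and>
         (\<forall>\<alpha>\<in>SL2Z.
           let a = \<alpha> $ 1 $ 1; c = \<alpha> $ 2 $ 1; g = real_of_int (gcd c (int N)) in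
           has_ord_q (slash k \<alpha> (klein_product N m))
             (g ^ 2 / (2 * real N) *
              (\<Sum>t = 1..N - 1. real_of_int (m t) *
                 (frac (of_int a * real t / g) * (frac (of_int a * real t / g) - 1)))))"
proof (intro conjI impI ballI)
  note expansion = q_unit_expansion_slash_klein_product[OF _ assms]
  have N: "2 * N > 0" using assms(1) by simp
  show "nearly_holomorphic_modular_form (Gamma1 N) k (klein_product N m)"
    if "[(\<Sum>t = 1..N - 1. m t * int t ^ 2) = 0] (mod (gcd 2 (int N) * int N))"
    unfolding nearly_holomorphic_modular_form_def
  proof (intro conjI ballI)
    \<comment> \<open>Holomorphy is the expansion at the identity matrix.\<close>
    have "mat 1 \<in> SL2Z" by (simp add: SL2Z_def)
    from expansion[OF this] have "slash k (mat 1) (klein_product N m)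
        holomorphic_on upper_half_plane"
      using N by (rule q_unit_expansion_imp_holomorphic)
    moreover have "slash k (mat 1) f = f" for f
      by (rule ext) (simp add: slash_def mat_def)
    ultimately show "klein_product N m holomorphic_on upper_half_plane" by simp
  next
    fix \<gamma> \<tau> assume "\<gamma> \<in> Gamma1 N" "\<tau> \<in> upper_half_plane"
    then show "slash k \<gamma> (klein_product N m) \<tau> = klein_product N m \<tau>"
      using slash_Gamma1_klein_product[OF _ assms that] by (simp add: upper_half_plane_def)
  next
    fix \<alpha> assume "\<alpha> \<in> SL2Z"
    from q_unit_expansion_imp_has_ord_q[OF expansion[OF this] N]
    show "\<exists>h a. has_q_expansion (slash k \<alpha> (klein_product N m)) h a"
      unfolding has_ord_q_def by blast
  qed
next
  fix \<alpha> assume \<alpha>: "\<alpha> \<in> SL2Z"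
  define g where "g = gcd (\<alpha> $ 2 $ 1) (int N)"
  define r where "r t = (\<alpha> $ 1 $ 1 * int t) mod g" for t
  have g: "g > 0" using assms(1) by (simp add: g_def)
  have frac: "frac (of_int (\<alpha> $ 1 $ 1) * real t / of_int g) = of_int (r t) / of_int g" for t
    using frac_divide_of_int[OF g, of "\<alpha> $ 1 $ 1 * int t"] by (simp add: r_def)
  have "has_ord_q (slash k \<alpha> (klein_product N m))
     (of_int (\<Sum>t = 1..N - 1. m t * (r t * (r t - g))) / real (2 * N))"
    unfolding r_def g_def by (rule q_unit_expansion_imp_has_ord_q[OF
        q_unit_expansion_slash_klein_product[OF \<alpha> assms]]) (use assms in auto)
  also have "of_int (\<Sum>t = 1..N - 1. m t * (r t * (r t - g))) / real (2 * N) =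
     (of_int g)\<^sup>2 / (2 * real N) * (\<Sum>t = 1..N - 1. real_of_int (m t) *
                 (frac (of_int (\<alpha> $ 1 $ 1) * real t / of_int g) * (frac (of_int (\<alpha> $ 1 $ 1) *
                     real t / of_int g) - 1)))"
    unfolding frac sum_distrib_left of_int_sum sum_divide_distrib
    by (intro sum.cong refl) (use g assms in \<open>simp add: field_simps power2_eq_square\<close>)
  finally show "let a = \<alpha> $ 1 $ 1; c = \<alpha> $ 2 $ 1; g = real_of_int (gcd c (int N)) in
           has_ord_q (slash k \<alpha> (klein_product N m))
             (g ^ 2 / (2 * real N) *
              (\<Sum>t = 1..N - 1. real_of_int (m t) *
                 (frac (of_int a * real t / g) * (frac (of_int a * real t / g) - 1))))"
    unfolding Let_def g_def .
qed

end
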